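(* Let $\alpha$ be a continuous action of a countable sofic group $G$ on a compact metrizable space $X$. Let $\Sigma$ be a sofic approximation sequence for $G$ and let $f$ be a real valued continuous function on $X$. Then $$P_{\Sigma}(f,X,G)=\sup\Big\{h_{\Sigma,\mu}(X,G)+\int_X f\,d\mu:\ \mu\in M_G(X)\Big\},$$ where $M_G(X)$ is the set of $G$-invariant Borel probability measures on $X$. In particular, if $P_{\Sigma}(f,X,G)\neq-\infty$ then $M_G(X)$ is nonempty.
   Context: **Sofic groups.** For $d\in\mathbb{N}$ write $[d]=\{1,\dots,d\}$ and $\mathrm{Sym}(d)$ for the permutation group of $[d]$. A sofic approximation sequence for a countable group $G$ is a sequence $\Sigma=\{\sigma_i:G\to\mathrm{Sym}(d_i)\}_{i\in\mathbb{N}}$ of maps (not necessarily homomorphisms; $d_i\in\mathbb{N}$; $\sigma_{i,s}=\sigma_i(s)$) such that (1) $\lim_{i}\frac{1}{d_i}|\{a\in[d_i]:\sigma_{i,s}\sigma_{i,t}(a)=\sigma_{i,st}(a)\}|=1$ for all $s,t\in G$; (2) $\lim_i\frac1{d_i}|\{a\in[d_i]:\sigma_{i,s}(a)\ne\sigma_{i,t}(a)\}|=1$ for all distinct $s,t\in G$; (3) $\lim_i d_i=\infty$. $G$ is sofic if such a sequence exists. The action is written $\alpha_s(x)=sx$. **Sofic topological pressure.** Let $\rho$ be a compatible metric on $X$. For maps $\varphi,\psi:[d]\to X$ put $\rho_2(\varphi,\psi)=\big(\frac1d\sum_{a=1}^d\rho(\varphi(a),\psi(a))^2\big)^{1/2}$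 and $\rho_\infty(\varphi,\psi)=\max_{1\le a\le d}\rho(\varphi(a),\psi(a))$. For a nonempty finite $F\subset G$, $\delta>0$ and $\sigma:G\to\mathrm{Sym}(d)$, let $\mathrm{Map}(\rho,F,\delta,\sigma)$ be the set of all $\varphi:[d]\to X$ with $\max_{s\in F}\rho_2(\alpha_s\circ\varphi,\varphi\circ\sigma_s)<\delta$. A subset $A$ of a (pseudo)metric space $(Y,d_Y)$ is $(d_Y,\varepsilon)$-separated if $d_Y(x,y)\ge\varepsilon$ for all distinct $x,y\in A$; $N_\varepsilon(Y,d_Y)$ is the maximal cardinality of a finite $(d_Y,\varepsilon)$-separated subset of $Y$. For $\varepsilon>0$ let $$M^\varepsilon_{\Sigma,\infty}(f,X,G,\rho,F,\delta,\sigma)=\sup_{\mathcal{E}}\sum_{\varphi\in\mathcal{E}}\exp\Big(\sum_{a=1}^d f(\varphi(a))\Big),$$ with $\mathcal{E}$ running over the $(\rho_\infty,\varepsilon)$-separated subsets of $\mathrm{Map}(\rho,F,\delta,\sigma)$. Define $$P_{\Sigma,\infty}(f,X,G,\rho)=\sup_{\varepsilon>0}\ \inf_{F}\ \inf_{\delta>0}\ \limsup_{i\to\infty}\frac1{d_i}\log M^\varepsilon_{\Sigma,\infty}(f,X,G,\rho,F,\delta,\sigma_i)\in[-\infty,+\infty],$$ $F$ running over nonempty finite subsets of $G$, with $\log 0=-\infty$ (so the limsup is $-\infty$ if $\mathrm{Map}(\rho,F,\delta,\sigma_i)=\emptyset$ for all large $i$). This value does not depend on the compatible metric $\rho$ and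 is denoted $P_\Sigma(f,X,G)$. **Sofic measure entropy.** Let $\mu\in M_G(X)$ and let $\rho$ be a compatible metric on $X$. For a nonempty finite set $L$ of real valued continuous functions on $X$, let $\mathrm{Map}_\mu(\rho,F,L,\delta,\sigma)$ be the set of $\varphi\in\mathrm{Map}(\rho,F,\delta,\sigma)$ with $\big|\frac1d\sum_{j=1}^d g(\varphi(j))-\int_X g\,d\mu\big|<\delta$ for all $g\in L$. Then $$h_{\Sigma,\mu}(X,G)=\sup_{\varepsilon>0}\ \inf_F\ \inf_L\ \inf_{\delta>0}\ \limsup_{i\to\infty}\frac1{d_i}\log N_\varepsilon(\mathrm{Map}_\mu(\rho,F,L,\delta,\sigma_i),\rho_\infty)\in[-\infty,+\infty],$$ $F$ and $L$ running over nonempty finite subsets of $G$ and of the real valued continuous functions on $X$ (the limsup is $-\infty$ if the sets are empty for all large $i$). This is independent of the compatible metric $\rho$. The supremum of the empty set is $-\infty$. *)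

theory Defs
  imports "HOL-Probability.Probability" "HOL-Algebra.Group_Action"
begin

section \<open>Sofic groups\<close>

text \<open>A sequence of maps \<open>\<sigma>\<^sub>i : G \<rightarrow> Sym(d\<^sub>i)\<close> is given by \<open>d :: nat \<Rightarrow> nat\<close> and
  \<open>\<sigma> :: nat \<Rightarrow> 'g \<Rightarrow> nat \<Rightarrow> nat\<close>, where \<open>\<sigma> i s\<close> permutes \<open>{1..d i}\<close>.\<close>

definition sofic_approximation ::
  "('g, 'b) monoid_scheme \<Rightarrow> (nat \<Rightarrow> nat) \<Rightarrow> (nat \<Rightarrow> 'g \<Rightarrow> nat \<Rightarrow> nat) \<Rightarrow> bool" where
  "sofic_approximation G d \<sigma> \<longleftrightarrow>
     (\<forall>i. 0 < d i) \<and>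
     (\<forall>i. \<forall>s\<in>carrier G. \<sigma> i s permutes {1..d i}) \<and>
     (\<forall>s\<in>carrier G. \<forall>t\<in>carrier G.
        (\<lambda>i. real (card {a \<in> {1..d i}. \<sigma> i s (\<sigma> i t a) = \<sigma> i (s \<otimes>\<^bsub>G\<^esub> t) a}) / real (d i))
          \<longlonglongrightarrow> 1) \<and>
     (\<forall>s\<in>carrier G. \<forall>t\<in>carrier G. s \<noteq> t \<longrightarrow>
        (\<lambda>i. real (card {a \<in> {1..d i}. \<sigma> i s a \<noteq> \<sigma> i t a}) / real (d i)) \<longlonglongrightarrow> 1) \<and>
     filterlim d at_top sequentially"

definition sofic_group :: "('g, 'b) monoid_scheme \<Rightarrow> bool" where
  "sofic_group G \<longleftrightarrow> group G \<and> countable (carrier G) \<and> (\<exists>d \<sigma>. sofic_approximation G d \<sigma>)"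

section \<open>Actions, compatible metrics and invariant measures\<close>

definition continuous_action ::
  "('g, 'b) monoid_scheme \<Rightarrow> 'x topology \<Rightarrow> ('g \<Rightarrow> 'x \<Rightarrow> 'x) \<Rightarrow> bool" where
  "continuous_action G X \<alpha> \<longleftrightarrow>
     group_action G (topspace X) \<alpha> \<and> (\<forall>s\<in>carrier G. continuous_map X X (\<alpha> s))"

definition compatible_metric :: "'x topology \<Rightarrow> ('x \<Rightarrow> 'x \<Rightarrow> real) \<Rightarrow> bool" where
  "compatible_metric X \<rho> \<longleftrightarrow>
     Metric_space (topspace X) \<rho> \<and> Metric_space.mtopology (topspace X) \<rho> = X"

definition borel_of :: "'x topology \<Rightarrow> 'x measure" where
  "borel_of X = sigma (topspace X) {U. openin X U}"

definition invariant_measures ::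
  "('g, 'b) monoid_scheme \<Rightarrow> 'x topology \<Rightarrow> ('g \<Rightarrow> 'x \<Rightarrow> 'x) \<Rightarrow> 'x measure set" where
  "invariant_measures G X \<alpha> =
     {\<mu>. prob_space \<mu> \<and> sets \<mu> = sets (borel_of X) \<and>
          (\<forall>s\<in>carrier G. distr \<mu> (borel_of X) (\<alpha> s) = \<mu>)}"

section \<open>Approximately equivariant maps\<close>

definition rho2 :: "('x \<Rightarrow> 'x \<Rightarrow> real) \<Rightarrow> nat \<Rightarrow> (nat \<Rightarrow> 'x) \<Rightarrow> (nat \<Rightarrow> 'x) \<Rightarrow> real" where
  "rho2 \<rho> d \<phi> \<psi> = sqrt ((1 / real d) * (\<Sum>a=1..d. (\<rho> (\<phi> a) (\<psi> a))\<^sup>2))"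

definition rho_inf :: "('x \<Rightarrow> 'x \<Rightarrow> real) \<Rightarrow> nat \<Rightarrow> (nat \<Rightarrow> 'x) \<Rightarrow> (nat \<Rightarrow> 'x) \<Rightarrow> real" where
  "rho_inf \<rho> d \<phi> \<psi> = Max ((\<lambda>a. \<rho> (\<phi> a) (\<psi> a)) ` {1..d})"

text \<open>Maps \<open>[d] \<rightarrow> X\<close> are taken extensional, so that distinct HOL functions are distinct maps.\<close>

definition sofic_Map ::
  "'x topology \<Rightarrow> ('g \<Rightarrow> 'x \<Rightarrow> 'x) \<Rightarrow> ('x \<Rightarrow> 'x \<Rightarrow> real) \<Rightarrow> 'g set \<Rightarrow> real \<Rightarrow>
   nat \<Rightarrow> ('g \<Rightarrow> nat \<Rightarrow> nat) \<Rightarrow> (nat \<Rightarrow> 'x) set" where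
  "sofic_Map X \<alpha> \<rho> F \<delta> d \<sigma> =
     {\<phi> \<in> {1..d} \<rightarrow>\<^sub>E topspace X. \<forall>s\<in>F. rho2 \<rho> d (\<alpha> s \<circ> \<phi>) (\<phi> \<circ> \<sigma> s) < \<delta>}"

definition sofic_Map_measure ::
  "'x topology \<Rightarrow> ('g \<Rightarrow> 'x \<Rightarrow> 'x) \<Rightarrow> 'x measure \<Rightarrow> ('x \<Rightarrow> 'x \<Rightarrow> real) \<Rightarrow> 'g set \<Rightarrow>
   ('x \<Rightarrow> real) set \<Rightarrow> real \<Rightarrow> nat \<Rightarrow> ('g \<Rightarrow> nat \<Rightarrow> nat) \<Rightarrow> (nat \<Rightarrow> 'x) set" where
  "sofic_Map_measure X \<alpha> \<mu> \<rho> F L \<delta> d \<sigma> =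
     {\<phi> \<in> sofic_Map X \<alpha> \<rho> F \<delta> d \<sigma>.
        \<forall>g\<in>L. \<bar>(1 / real d) * (\<Sum>j=1..d. g (\<phi> j)) - integral\<^sup>L \<mu> g\<bar> < \<delta>}"

definition eps_separated :: "('y \<Rightarrow> 'y \<Rightarrow> real) \<Rightarrow> real \<Rightarrow> 'y set \<Rightarrow> bool" where
  "eps_separated dY \<epsilon> A \<longleftrightarrow> (\<forall>x\<in>A. \<forall>y\<in>A. x \<noteq> y \<longrightarrow> \<epsilon> \<le> dY x y)"

definition sep_number :: "real \<Rightarrow> 'y set \<Rightarrow> ('y \<Rightarrow> 'y \<Rightarrow> real) \<Rightarrow> ereal" where
  "sep_number \<epsilon> Y dY =
     (SUP A \<in> {A. finite A \<and> A \<subseteq> Y \<and> eps_separated dY \<epsilon> A}. ereal (real (card A)))"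

text \<open>The logarithm on \<open>[0, \<infinity>]\<close> with \<open>log 0 = -\<infinity>\<close> and \<open>log \<infinity> = \<infinity>\<close>; the value on
  negative numbers is irrelevant.\<close>

definition elog :: "ereal \<Rightarrow> ereal" where
  "elog x = (if x \<le> 0 then -\<infinity> else if x = \<infinity> then \<infinity> else ereal (ln (real_of_ereal x)))"

section \<open>Pressure and measure entropy\<close>

text \<open>The separated sets are required to be finite because a HOL sum over an infinite set is \<open>0\<close>.
  For compact \<open>X\<close>, \<open>d > 0\<close> and \<open>\<epsilon> > 0\<close> a separated set of maps \<open>[d] \<rightarrow> X\<close> is always finite,
  so this excludes nothing.\<close>

definition sofic_M ::
  "real \<Rightarrow> ('x \<Rightarrow> real) \<Rightarrow> 'x topology \<Rightarrow> ('g \<Rightarrow> 'x \<Rightarrow> 'x) \<Rightarrow> ('x \<Rightarrow> 'x \<Rightarrow> real) \<Rightarrow>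
   'g set \<Rightarrow> real \<Rightarrow> nat \<Rightarrow> ('g \<Rightarrow> nat \<Rightarrow> nat) \<Rightarrow> ereal" where
  "sofic_M \<epsilon> f X \<alpha> \<rho> F \<delta> d \<sigma> =
     (SUP E \<in> {E. finite E \<and> E \<subseteq> sofic_Map X \<alpha> \<rho> F \<delta> d \<sigma> \<and> eps_separated (rho_inf \<rho> d) \<epsilon> E}.
        ereal (\<Sum>\<phi>\<in>E. exp (\<Sum>a=1..d. f (\<phi> a))))"

definition sofic_pressure ::
  "('g, 'b) monoid_scheme \<Rightarrow> (nat \<Rightarrow> nat) \<Rightarrow> (nat \<Rightarrow> 'g \<Rightarrow> nat \<Rightarrow> nat) \<Rightarrow>
   'x topology \<Rightarrow> ('g \<Rightarrow> 'x \<Rightarrow> 'x) \<Rightarrow> ('x \<Rightarrow> 'x \<Rightarrow> real) \<Rightarrow> ('x \<Rightarrow> real) \<Rightarrow> ereal" where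
  "sofic_pressure G d \<sigma> X \<alpha> \<rho> f =
     (SUP \<epsilon> \<in> {0<..}. INF F \<in> {F. F \<noteq> {} \<and> finite F \<and> F \<subseteq> carrier G}. INF \<delta> \<in> {0<..}.
        limsup (\<lambda>i. ereal (1 / real (d i)) * elog (sofic_M \<epsilon> f X \<alpha> \<rho> F \<delta> (d i) (\<sigma> i))))"

definition sofic_measure_entropy ::
  "('g, 'b) monoid_scheme \<Rightarrow> (nat \<Rightarrow> nat) \<Rightarrow> (nat \<Rightarrow> 'g \<Rightarrow> nat \<Rightarrow> nat) \<Rightarrow>
   'x topology \<Rightarrow> ('g \<Rightarrow> 'x \<Rightarrow> 'x) \<Rightarrow> ('x \<Rightarrow> 'x \<Rightarrow> real) \<Rightarrow> 'x measure \<Rightarrow> ereal" where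
  "sofic_measure_entropy G d \<sigma> X \<alpha> \<rho> \<mu> =
     (SUP \<epsilon> \<in> {0<..}. INF F \<in> {F. F \<noteq> {} \<and> finite F \<and> F \<subseteq> carrier G}.
      INF L \<in> {L. L \<noteq> {} \<and> finite L \<and> (\<forall>g\<in>L. continuous_map X euclideanreal g)}. INF \<delta> \<in> {0<..}.
        limsup (\<lambda>i. ereal (1 / real (d i)) *
          elog (sep_number \<epsilon> (sofic_Map_measure X \<alpha> \<mu> \<rho> F L \<delta> (d i) (\<sigma> i))
                 (rho_inf \<rho> (d i)))))"

end

theory Submission
  imports Defs
begin

text \<open>
The pressure weights a separated set of almost equivariant maps \<open>\<phi>\<close> by \<open>exp (\<Sum>a. f (\<phi> a))\<close>, while
the entropy of \<open>\<mu>\<close> counts only those maps whose empirical measure is close to \<open>\<mu>\<close>.  For such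
maps the exponent is about \<open>d * \<integral>f d\<mu>\<close>, so entropy plus integral never exceeds the pressure
(\<open>entropy_plus_integral_le_pressure\<close>).

For the other inequality, the maps are divided into finitely many regions according to their
empirical measure.  The number of regions is fixed while \<open>d\<close> tends to infinity, so one
region carries almost the whole exponential growth of the pressure (\<open>pigeonhole_averages\<close>).  Making
the regions smaller and the equivariance better produces a sequence of empirical measures, and
weak compactness gives a limit \<open>\<mu>\<close>.  Averages over almost equivariant maps are almost invariant
(\<open>emp_avg_almost_invariant\<close>), so \<open>\<mu>\<close> is invariant, and the maps in the chosen regions are
counted by its entropy (\<open>exists_measure_of_less_pressure\<close>).

Weak compactness on \<open>X\<close> is reduced to Helly's selection theorem on the real line.  A compact metric
space has an injective code \<open>c\<close> into \<open>[0, 1]\<close> with uniformly continuous inverse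
(\<open>totally_bounded_code\<close>), and every continuous function on \<open>X\<close> is the composition of \<open>c\<close> with a bounded
continuous function on the line (\<open>continuous_function_factors\<close>).  Hence weak limits of coded
measures can be decoded (\<open>empirical_subsequence_converges\<close>), and by Bernstein's theorem the
averages of countably many polynomials in \<open>c\<close> determine the averages of all continuous functions
(\<open>Bernstein_window_determines\<close>), which is how regions of empirical measures are described.
\<close>

section \<open>Coding a compact metric space by real numbers\<close>

text \<open>Binary words are written as base-three expansions with the digits \<open>0\<close> and \<open>1\<close>: the
digits after place \<open>n\<close> weigh together only half as much as a digit \<open>1\<close> at place \<open>n\<close>, so two words
that first differ at place \<open>n\<close> are apart by a definite amount.  In base two, carries
would spoil this.\<close>

definition ternary :: "(nat \<Rightarrow> bool) \<Rightarrow> real" where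
  "ternary b = (\<Sum>k. of_bool (b k) * (1 / 3) ^ Suc k)"

lemma summable_third: "summable (\<lambda>k. (1 / 3 :: real) ^ Suc k)"
  by (simp add: summable_geometric summable_mult)

lemma summable_ternary: "summable (\<lambda>k. of_bool (b k) * (1 / 3 :: real) ^ Suc k)"
  by (rule summable_comparison_test[OF _ summable_third]) auto

lemma ternary_nonneg: "0 \<le> ternary b"
  unfolding ternary_def by (intro suminf_nonneg summable_ternary) auto

lemma suminf_third: "(\<Sum>k. (1 / 3 :: real) ^ Suc k) = 1 / 2"
  using suminf_geometric[of "1/3::real"] suminf_mult[of "\<lambda>k. (1/3::real)^k" "1/3"]
  by (simp add: summable_geometric)

lemma ternary_le_half: "ternary b \<le> 1 / 2"
proof -
  have "ternary b \<le> (\<Sum>k. (1 / 3 :: real) ^ Suc k)"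
    unfolding ternary_def by (intro suminf_le summable_ternary summable_third) auto
  then show ?thesis by (simp only: suminf_third)
qed

lemma ternary_split:
  "ternary b = (\<Sum>k<n. of_bool (b k) * (1 / 3) ^ Suc k) + of_bool (b n) * (1 / 3) ^ Suc n
     + (1 / 3) ^ Suc n * ternary (\<lambda>k. b (Suc n + k))"
proof -
  have "ternary b = (\<Sum>k. of_bool (b (k + Suc n)) * (1 / 3) ^ Suc (k + Suc n))
     + (\<Sum>k<Suc n. of_bool (b k) * (1 / 3) ^ Suc k)"
    unfolding ternary_def by (rule suminf_split_initial_segment[OF summable_ternary])
  also have "(\<lambda>k. of_bool (b (k + Suc n)) * (1 / 3 :: real) ^ Suc (k + Suc n)) =
     (\<lambda>k. (1 / 3) ^ Suc n * (of_bool (b (Suc n + k)) * (1 / 3) ^ Suc k))"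
    by (auto simp: fun_eq_iff power_add add.commute)
  also have "(\<Sum>k. (1 / 3) ^ Suc n * (of_bool (b (Suc n + k)) * (1 / 3 :: real) ^ Suc k))
     = (1 / 3) ^ Suc n * ternary (\<lambda>k. b (Suc n + k))"
    unfolding ternary_def by (rule suminf_mult[OF summable_ternary])
  finally show ?thesis by simp
qed

lemma ternary_close_imp_agree:
  assumes "\<bar>ternary b - ternary b'\<bar> < (1 / 3) ^ Suc N / 2" "k \<le> N"
  shows "b k = b' k"
proof (rule ccontr)
  assume "b k \<noteq> b' k"
  define m where "m = (LEAST j. b j \<noteq> b' j)"
  have m: "b m \<noteq> b' m" "m \<le> k" "\<And>j. j < m \<Longrightarrow> b j = b' j"
    using \<open>b k \<noteq> b' k\<close> LeastI[of "\<lambda>j. b j \<noteq> b' j"] Least_le[of "\<lambda>j. b j \<noteq> b' j"] not_less_Least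
    unfolding m_def by blast+
  let ?t = "ternary (\<lambda>k. b (Suc m + k))" and ?t' = "ternary (\<lambda>k. b' (Suc m + k))"
  let ?p = "(1 / 3 :: real) ^ Suc m"
  have "(\<Sum>k<m. of_bool (b k) * (1 / 3) ^ Suc k) = (\<Sum>k<m. of_bool (b' k) * (1 / 3 :: real) ^ Suc k)"
    using m(3) by (intro sum.cong) auto
  then have eq: "ternary b - ternary b' = ?p * (of_bool (b m) - of_bool (b' m) + ?t - ?t')"
    using ternary_split[of b m] ternary_split[of b' m] by (simp add: algebra_simps)
  have "\<bar>of_bool (b m) - of_bool (b' m) + ?t - ?t'\<bar> \<ge> 1 / 2"
    using m(1) ternary_nonneg[of "\<lambda>k. b (Suc m + k)"] ternary_nonneg[of "\<lambda>k. b' (Suc m + k)"]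
      ternary_le_half[of "\<lambda>k. b (Suc m + k)"] ternary_le_half[of "\<lambda>k. b' (Suc m + k)"]
    by (cases "b m"; cases "b' m") auto
  then have "?p * (1 / 2) \<le> \<bar>ternary b - ternary b'\<bar>"
    unfolding eq abs_mult by (intro mult_mono) auto
  moreover have "(1 / 3 :: real) ^ Suc N \<le> ?p"
    using m(2) assms(2) by (intro power_decreasing) auto
  ultimately show False using assms(1) by linarith
qed

text \<open>List all balls of radius \<open>1 / (n + 1)\<close> around finitely many centres, for all \<open>n\<close>, in one sequence
\<open>U\<close>, and code a point by the word that records in which \<open>U k\<close> it lies.  If the codes of two points
are close, the points lie in the same early sets \<open>U k\<close>, hence in a common small ball.  The
code itself need not be continuous; only its inverse is used as a continuous map.\<close>

lemma (in Metric_space) totally_bounded_code: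
  assumes "mtotally_bounded M"
  obtains c :: "'a \<Rightarrow> real"
  where "\<And>x. c x \<in> {0..1}"
    and "\<And>e. 0 < e \<Longrightarrow> \<exists>\<theta>>0. \<forall>x\<in>M. \<forall>y\<in>M. \<bar>c x - c y\<bar> < \<theta> \<longrightarrow> d x y < e"
proof -
  have "\<forall>n::nat. \<exists>K. finite K \<and> K \<subseteq> M \<and> M \<subseteq> (\<Union>x\<in>K. mball x (1 / Suc n))"
    using assms by (simp add: mtotally_bounded_def)
  then obtain K where K: "\<And>n. finite (K n)" "\<And>n. K n \<subseteq> M"
      "\<And>n. M \<subseteq> (\<Union>x\<in>K n. mball x (1 / Suc n))"
    by metis
  define \<B> where "\<B> = insert {} (\<Union>n. (\<lambda>x. mball x (1 / Suc n)) ` K n)"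
  have "countable (\<Union>n. (\<lambda>x. mball x (1 / Suc n)) ` K n)"
    by (rule countable_UN[OF countableI_type]) (simp add: K(1) countable_finite)
  then have "countable \<B>" "\<B> \<noteq> {}"
    unfolding \<B>_def by auto
  define U where "U = from_nat_into \<B>"
  have rangeU: "range U = \<B>"
    unfolding U_def by (simp add: \<open>countable \<B>\<close> \<open>\<B> \<noteq> {}\<close>)
  define c where "c x = ternary (\<lambda>k. x \<in> U k)" for x
  show thesis
  proof
    show "c x \<in> {0..1}" for x
      using ternary_nonneg[of "\<lambda>k. x \<in> U k"] ternary_le_half[of "\<lambda>k. x \<in> U k"]
      by (simp add: c_def)
  next
    fix e :: real assume "0 < e"
    then obtain n where n: "1 / Suc n < e / 2"
      using nat_approx_posE[of "e / 2"] by auto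
    have "\<exists>k. U k = mball x (1 / Suc n)" if "x \<in> K n" for x
    proof -
      have "mball x (1 / Suc n) \<in> range U"
        unfolding rangeU \<B>_def using that by blast
      then show ?thesis by force
    qed
    then obtain idx where idx: "\<And>x. x \<in> K n \<Longrightarrow> U (idx x) = mball x (1 / Suc n)"
      by metis
    define N where "N = Max (insert 0 (idx ` K n))"
    have N: "idx x \<le> N" if "x \<in> K n" for x
      using that K(1) by (auto simp: N_def)
    show "\<exists>\<theta>>0. \<forall>x\<in>M. \<forall>y\<in>M. \<bar>c x - c y\<bar> < \<theta> \<longrightarrow> d x y < e"
    proof (intro exI conjI ballI impI)
      show "0 < (1 / 3 :: real) ^ Suc N / 2" by simp
    next
      fix x y assume "x \<in> M" "y \<in> M" and close: "\<bar>c x - c y\<bar> < (1 / 3) ^ Suc N / 2"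
      then obtain z where z: "z \<in> K n" "x \<in> mball z (1 / Suc n)"
        using K(3) by blast
      then have "y \<in> mball z (1 / Suc n)"
        using ternary_close_imp_agree[OF close[unfolded c_def] N[OF z(1)]] idx[OF z(1)] by simp
      with z(2) have "d z x < 1 / Suc n" "d z y < 1 / Suc n" "z \<in> M" by auto
      then show "d x y < e"
        using triangle[of x z y] commute[of x z] n \<open>x \<in> M\<close> \<open>y \<in> M\<close> by linarith
    qed
  qed
qed

text \<open>The code transports everything about \<open>X\<close> to the real line: a continuous function on \<open>X\<close> becomes a
uniformly continuous function of the code, and measures on \<open>X\<close> become distributions on \<open>[0, 1]\<close>.\<close>

locale coded_compact_space =
  fixes X :: "'x topology" and \<rho> :: "'x \<Rightarrow> 'x \<Rightarrow> real" and c :: "'x \<Rightarrow> real"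
  assumes compact: "compact_space X"
    and metric: "compatible_metric X \<rho>"
    and code_range: "c x \<in> {0..1}"
    and code_inverse: "0 < e \<Longrightarrow>
      \<exists>\<theta>>0. \<forall>x\<in>topspace X. \<forall>y\<in>topspace X. \<bar>c x - c y\<bar> < \<theta> \<longrightarrow> \<rho> x y < e"

lemma ex_coded_compact_space:
  assumes "compact_space X" "compatible_metric X \<rho>"
  shows "\<exists>c. coded_compact_space X \<rho> c"
proof -
  interpret Metric_space "topspace X" \<rho>
    using assms by (simp add: compatible_metric_def)
  have "mtotally_bounded (topspace X)"
    using assms compact_space_eq_mcomplete_mtotally_bounded by (simp add: compatible_metric_def)
  then show ?thesis
    using assms by (elim totally_bounded_code) (auto simp: coded_compact_space_def)
qed

context coded_compact_space
begin

sublocale Metric_space "topspace X" \<rho>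
  using metric by (simp add: compatible_metric_def)

lemma topology_eq: "mtopology = X"
  using metric by (simp add: compatible_metric_def)

lemma continuous_function_bounded:
  assumes "continuous_map X euclideanreal h"
  obtains B where "0 < B" "\<And>x. x \<in> topspace X \<Longrightarrow> \<bar>h x\<bar> \<le> B"
proof -
  have "compactin euclideanreal (h ` topspace X)"
    using compact assms by (intro image_compactin) (auto simp: compact_space_def)
  then have "bounded (h ` topspace X)"
    by (simp add: compact_imp_bounded)
  then show thesis
    using that by (auto simp: bounded_pos)
qed

lemma continuous_function_uniform:
  assumes "continuous_map X euclideanreal h" "0 < e"
  obtains \<theta> where "0 < \<theta>" "\<And>x y. x \<in> topspace X \<Longrightarrow> y \<in> topspace X \<Longrightarrow> \<rho> x y < \<theta> \<Longrightarrow> \<bar>h x - h y\<bar> < e"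
proof -
  have "uniformly_continuous_map (metric (topspace X, \<rho>)) euclidean_metric h"
    using compact assms by (intro continuous_imp_uniformly_continuous_map) (simp add: topology_eq)
  then show thesis
    using assms(2) that by (fastforce simp: uniformly_continuous_map_def dist_real_def)
qed

text \<open>On the set of codes, \<open>h \<circ> c\<inverse>\<close> is uniformly continuous, as a composition of two
uniformly continuous maps.  It therefore extends to the closure of that set, and by Tietze's theorem
with the same bound to the whole line.\<close>

lemma continuous_function_factors:
  assumes "continuous_map X euclideanreal h"
  obtains H B where "continuous_on UNIV H" "\<And>t. \<bar>H t\<bar> \<le> B" "\<And>x. x \<in> topspace X \<Longrightarrow> H (c x) = h x"
proof -
  define S where "S = c ` topspace X"
  define g where "g = h \<circ> inv_into (topspace X) c"
  have inj: "inj_on c (topspace X)"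
  proof (rule inj_onI)
    fix x y assume xy: "x \<in> topspace X" "y \<in> topspace X" "c x = c y"
    have "\<rho> x y < e" if "0 < e" for e
      using code_inverse[OF that] xy by force
    then show "x = y"
      using xy by (metis less_irrefl zero mdist_pos_less)
  qed
  then have g: "g (c x) = h x" if "x \<in> topspace X" for x
    using that by (simp add: g_def)
  obtain B where B: "0 < B" "\<And>x. x \<in> topspace X \<Longrightarrow> \<bar>h x\<bar> \<le> B"
    using continuous_function_bounded[OF assms] by blast
  have "uniformly_continuous_on S g"
    unfolding uniformly_continuous_on_def
  proof (intro allI impI)
    fix e :: real assume "0 < e"
    then obtain \<eta> where \<eta>: "0 < \<eta>"
        "\<And>x y. x \<in> topspace X \<Longrightarrow> y \<in> topspace X \<Longrightarrow> \<rho> x y < \<eta> \<Longrightarrow> \<bar>h x - h y\<bar> < e"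
      using continuous_function_uniform[OF assms] by blast
    obtain \<theta> where "0 < \<theta>" "\<forall>x\<in>topspace X. \<forall>y\<in>topspace X. \<bar>c x - c y\<bar> < \<theta> \<longrightarrow> \<rho> x y < \<eta>"
      using code_inverse[OF \<eta>(1)] by blast
    with \<eta> show "\<exists>d>0. \<forall>x\<in>S. \<forall>x'\<in>S. dist x' x < d \<longrightarrow> dist (g x') (g x) < e"
      by (intro exI[of _ \<theta>]) (auto simp: S_def g dist_real_def)
  qed
  then obtain g' where g': "uniformly_continuous_on (closure S) g'" "\<And>t. t \<in> S \<Longrightarrow> g t = g' t"
    by (rule uniformly_continuous_on_extension_on_closure) blast
  have "continuous_on (closure S) g'"
    using g'(1) by (rule uniformly_continuous_imp_continuous)
  have "\<bar>g' t\<bar> \<le> B" if "t \<in> closure S" for t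
    using continuous_on_closure_norm_le[OF \<open>continuous_on (closure S) g'\<close> _ that, of B] g'(2) g B(2)
    by (auto simp: S_def)
  then obtain H where "continuous_on UNIV H" "\<And>t. t \<in> closure S \<Longrightarrow> H t = g' t" "\<And>t. \<bar>H t\<bar> \<le> B"
    using Tietze[OF \<open>continuous_on (closure S) g'\<close>, of UNIV B] B(1) by auto
  moreover have "H (c x) = h x" if "x \<in> topspace X" for x
    using calculation(2)[of "c x"] g'(2)[of "c x"] g[OF that] closure_subset[of S] that
    by (auto simp: S_def)
  ultimately show thesis using that by blast
qed

end

section \<open>Averages and Bernstein polynomials\<close>

text \<open>The integral of \<open>h\<close> against the empirical measure of \<open>\<phi>\<close>, the image under \<open>\<phi>\<close> of the
uniform distribution on \<open>{1..n}\<close>.\<close>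

definition emp_avg :: "nat \<Rightarrow> (nat \<Rightarrow> 'x) \<Rightarrow> ('x \<Rightarrow> real) \<Rightarrow> real" where
  "emp_avg n \<phi> h = 1 / real n * (\<Sum>j=1..n. h (\<phi> j))"

lemma emp_avg_mono:
  assumes "\<And>j. j \<in> {1..n} \<Longrightarrow> h (\<phi> j) \<le> h' (\<phi>' j)"
  shows "emp_avg n \<phi> h \<le> emp_avg n \<phi>' h'"
  unfolding emp_avg_def using assms by (intro mult_left_mono sum_mono) auto

lemma emp_avg_const: "0 < n \<Longrightarrow> emp_avg n \<phi> (\<lambda>_. r) = r"
  by (simp add: emp_avg_def)

lemma emp_avg_abs_le:
  assumes "0 < n" "\<And>j. j \<in> {1..n} \<Longrightarrow> \<bar>h (\<phi> j)\<bar> \<le> B"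
  shows "\<bar>emp_avg n \<phi> h\<bar> \<le> B"
proof -
  have "emp_avg n \<phi> h \<le> emp_avg n \<phi> (\<lambda>_. B)" "emp_avg n \<phi> (\<lambda>_. - B) \<le> emp_avg n \<phi> h"
    using assms(2) by (intro emp_avg_mono; force simp: abs_le_iff)+
  then show ?thesis by (simp add: emp_avg_const[OF assms(1)] abs_le_iff)
qed

lemma emp_avg_diff: "emp_avg n \<phi> (\<lambda>x. h x - h' x) = emp_avg n \<phi> h - emp_avg n \<phi> h'"
  by (simp add: emp_avg_def sum_subtractf algebra_simps)

lemma emp_avg_lincomb:
  "emp_avg n \<phi> (\<lambda>x. \<Sum>k\<in>K. a k * u k x) = (\<Sum>k\<in>K. a k * emp_avg n \<phi> (u k))"
  unfolding emp_avg_def by (simp add: sum_distrib_left sum_distrib_right algebra_simps)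
    (rule sum.swap)

lemma emp_avg_integral:
  assumes "0 < n"
  shows "measure_pmf.expectation (pmf_of_set {1..n}) (\<lambda>j. h (\<phi> j)) = emp_avg n \<phi> h"
  using assms by (simp add: integral_pmf_of_set emp_avg_def)

text \<open>An increasing sequence of finite sets of test functions which together control the averages of
all continuous functions.  Bernstein polynomials of the code replace a countable dense subset of the
continuous functions.  As functions on \<open>X\<close> they need not be continuous, but they are
bounded, which is all that averages over finite sets require.\<close>

definition Bernstein_window :: "('x \<Rightarrow> real) \<Rightarrow> nat \<Rightarrow> ('x \<Rightarrow> real) set" where
  "Bernstein_window c n = {\<lambda>x. Bernstein m k (c x) | m k. k \<le> m \<and> m \<le> n}"

lemma finite_Bernstein_window: "finite (Bernstein_window c n)"
proof -
  have "Bernstein_window c n = (\<lambda>(m, k) x. Bernstein m k (c x)) ` (SIGMA m:{..n}. {..m})"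
    by (auto simp: Bernstein_window_def image_iff)
  then show ?thesis by simp
qed

lemma Bernstein_le_one:
  assumes "0 \<le> t" "t \<le> 1" "k \<le> m"
  shows "Bernstein m k t \<le> 1"
  using sum_mono2[of "{..m}" "{k}" "\<lambda>k. Bernstein m k t"] assms Bernstein_nonneg by auto

lemma (in coded_compact_space) Bernstein_window_bounded:
  "u \<in> Bernstein_window c n \<Longrightarrow> \<bar>u x\<bar> \<le> 1"
  using code_range[of x] Bernstein_nonneg Bernstein_le_one by (fastforce simp: Bernstein_window_def)

text \<open>A continuous \<open>h\<close> is a continuous function \<open>H\<close> of the code, and the Bernstein approximation of \<open>H\<close>
is a linear combination of window functions whose coefficients are values of \<open>H\<close>; this turns
closeness of the averages over the window into closeness of the averages of \<open>h\<close>.\<close>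

lemma (in coded_compact_space) Bernstein_window_determines:
  assumes "continuous_map X euclideanreal h" "0 < e"
  obtains N \<eta> where "0 < \<eta>"
    "\<And>n n' \<phi> \<phi>'. 0 < n \<Longrightarrow> 0 < n' \<Longrightarrow> \<phi> \<in> {1..n} \<rightarrow> topspace X \<Longrightarrow> \<phi>' \<in> {1..n'} \<rightarrow> topspace X \<Longrightarrow>
       (\<And>u. u \<in> Bernstein_window c N \<Longrightarrow> \<bar>emp_avg n \<phi> u - emp_avg n' \<phi>' u\<bar> \<le> \<eta>) \<Longrightarrow>
       \<bar>emp_avg n \<phi> h - emp_avg n' \<phi>' h\<bar> < e"
proof -
  obtain H B where H: "continuous_on UNIV H" "\<And>t. \<bar>H t\<bar> \<le> B"
      "\<And>x. x \<in> topspace X \<Longrightarrow> H (c x) = h x"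
    using continuous_function_factors[OF assms(1)] by blast
  have "0 \<le> B" using H(2)[of 0] by linarith
  have "continuous_on {0..1} H" using H(1) continuous_on_subset by blast
  then obtain N where N: "\<And>t. t \<in> {0..1} \<Longrightarrow>
      \<bar>H t - (\<Sum>k\<le>N. H (k / N) * Bernstein N k t)\<bar> < e / 4"
    using Bernstein_Weierstrass[of H "e / 4"] assms(2) by auto
  define p where "p x = (\<Sum>k\<le>N. H (k / N) * Bernstein N k (c x))" for x
  \<comment> \<open>The approximation has \<open>N + 1\<close> coefficients, each at most \<open>B\<close> in
    absolute value, so this choice makes the averages of \<open>p\<close> differ by at most \<open>e / 4\<close>.\<close>
  define \<eta> where "\<eta> = e / (4 * (Suc N * (B + 1)))"
  have "0 < \<eta>" using assms(2) \<open>0 \<le> B\<close> by (simp add: \<eta>_def)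
  have approx: "\<bar>emp_avg n \<phi> h - emp_avg n \<phi> p\<bar> \<le> e / 4"
    if "0 < n" "\<phi> \<in> {1..n} \<rightarrow> topspace X" for n \<phi>
    unfolding emp_avg_diff[symmetric]
  proof (rule emp_avg_abs_le[OF that(1)])
    fix j assume "j \<in> {1..n}"
    then have "H (c (\<phi> j)) = h (\<phi> j)" using that(2) H(3) by blast
    then show "\<bar>h (\<phi> j) - p (\<phi> j)\<bar> \<le> e / 4"
      using N[OF code_range[of "\<phi> j"]] by (simp add: p_def)
  qed
  show thesis
  proof (rule that[OF \<open>0 < \<eta>\<close>, of N])
    fix n n' :: nat and \<phi> \<phi>'
    assume n: "0 < n" "0 < n'" and \<phi>: "\<phi> \<in> {1..n} \<rightarrow> topspace X" "\<phi>' \<in> {1..n'} \<rightarrow> topspace X"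
      and close: "\<And>u. u \<in> Bernstein_window c N \<Longrightarrow> \<bar>emp_avg n \<phi> u - emp_avg n' \<phi>' u\<bar> \<le> \<eta>"
    let ?D = "\<lambda>k. emp_avg n \<phi> (\<lambda>x. Bernstein N k (c x)) - emp_avg n' \<phi>' (\<lambda>x. Bernstein N k (c x))"
    have "emp_avg n \<phi> p - emp_avg n' \<phi>' p = (\<Sum>k\<le>N. H (k / N) * ?D k)"
      unfolding p_def[abs_def] emp_avg_lincomb by (simp add: sum_subtractf algebra_simps)
    also have "\<bar>\<dots>\<bar> \<le> (\<Sum>k\<le>N. \<bar>H (k / N) * ?D k\<bar>)" by (rule sum_abs)
    also have "\<dots> \<le> (\<Sum>k\<le>N. (B + 1) * \<eta>)"
    proof (rule sum_mono)
      fix k assume "k \<in> {..N}"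
      then have "(\<lambda>x. Bernstein N k (c x)) \<in> Bernstein_window c N"
        by (auto simp: Bernstein_window_def)
      then show "\<bar>H (k / N) * ?D k\<bar> \<le> (B + 1) * \<eta>"
        unfolding abs_mult using H(2)[of "k / N"] close \<open>0 \<le> B\<close> by (intro mult_mono) auto
    qed
    also have "\<dots> = real (Suc N) * (B + 1) * \<eta>" by simp
    also have "\<dots> = e / 4"
      unfolding \<eta>_def using \<open>0 \<le> B\<close> by (simp add: divide_simps del: of_nat_Suc)
    finally have "\<bar>emp_avg n \<phi> p - emp_avg n' \<phi>' p\<bar> \<le> e / 4" .
    then show "\<bar>emp_avg n \<phi> h - emp_avg n' \<phi>' h\<bar> < e"
      using approx[OF n(1) \<phi>(1)] approx[OF n(2) \<phi>(2)] assms(2) by linarith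
  qed
qed

section \<open>Weak limits of empirical measures\<close>

lemma space_borel_of [simp]: "space (borel_of X) = topspace X"
  unfolding borel_of_def by (rule space_measure_of) (auto dest: openin_subset)

lemma sets_borel_of: "sets (borel_of X) = sigma_sets (topspace X) {U. openin X U}"
  unfolding borel_of_def by (rule sets_measure_of) (auto dest: openin_subset)

lemma borel_of_measurable:
  assumes "g \<in> space N \<rightarrow> topspace X" "\<And>U. openin X U \<Longrightarrow> g -` U \<inter> space N \<in> sets N"
  shows "g \<in> measurable N (borel_of X)"
  using assms by (intro measurable_sigma_sets[OF sets_borel_of]) (auto dest: openin_subset)

lemma continuous_map_measurable_borel_of:
  assumes "continuous_map X Y g"
  shows "g \<in> measurable (borel_of X) (borel_of Y)"
proof (rule borel_of_measurable)
  show "g \<in> space (borel_of X) \<rightarrow> topspace Y"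
    using continuous_map_funspace[OF assms] by simp
  fix U assume "openin Y U"
  then have "openin X {x \<in> topspace X. g x \<in> U}"
    using assms by (simp add: continuous_map)
  moreover have "g -` U \<inter> space (borel_of X) = {x \<in> topspace X. g x \<in> U}" by auto
  ultimately show "g -` U \<inter> space (borel_of X) \<in> sets (borel_of X)"
    by (simp add: sets_borel_of sigma_sets.Basic)
qed

lemma continuous_map_borel_measurable:
  fixes h :: "'x \<Rightarrow> real"
  assumes "continuous_map X euclideanreal h"
  shows "h \<in> borel_measurable (borel_of X)"
proof -
  have "sets (borel_of euclideanreal) = sets (borel :: real measure)"
    by (simp add: sets_borel_of borel_def)
  then show ?thesis
    using continuous_map_measurable_borel_of[OF assms] measurable_cong_sets by blast
qed

context coded_compact_space
begin

text \<open>The distance to \<open>C\<close>, or a constant if \<open>C\<close> is empty.  It is what lets integrals of continuous functions see closed sets,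
both in the uniqueness of measures and in the measurability of the decoder below.\<close>

lemma closed_zero_set:
  assumes "closedin X C"
  obtains h where "continuous_map X euclideanreal h" "\<And>x. x \<in> topspace X \<Longrightarrow> 0 \<le> h x"
    "\<And>x. x \<in> topspace X \<Longrightarrow> h x = 0 \<longleftrightarrow> x \<in> C"
proof (cases "C = {}")
  case True
  show ?thesis
    by (rule that[of "\<lambda>_. 1"]) (auto simp: True)
next
  case False
  have C: "C \<subseteq> topspace X" using assms closedin_subset by blast
  define h where "h x = (INF y\<in>C. \<rho> x y)" for x
  have bdd: "bdd_below (\<rho> x ` C)" for x by (rule bdd_belowI[of _ 0]) auto
  have lower: "h x \<le> \<rho> x y" if "y \<in> C" for x y
    unfolding h_def using that bdd by (rule cINF_lower[rotated])
  have nonneg: "0 \<le> h x" for x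
    unfolding h_def using False by (intro cINF_greatest) auto
  have lip: "h x - \<rho> x x' \<le> h x'" if "x \<in> topspace X" "x' \<in> topspace X" for x x'
    unfolding h_def[of x'] using False
  proof (rule cINF_greatest)
    fix y assume "y \<in> C"
    then show "h x - \<rho> x x' \<le> \<rho> x' y"
      using lower[of y x] triangle[of x x' y] C that by auto
  qed
  have "uniformly_continuous_map (metric (topspace X, \<rho>)) euclidean_metric h"
    unfolding uniformly_continuous_map_def
  proof (intro conjI allI impI)
    fix e :: real assume "0 < e"
    show "\<exists>\<delta>>0. \<forall>x\<in>mspace (metric (topspace X, \<rho>)). \<forall>y\<in>mspace (metric (topspace X, \<rho>)).
        mdist (metric (topspace X, \<rho>)) y x < \<delta> \<longrightarrow> mdist euclidean_metric (h y) (h x) < e"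
    proof (intro exI[of _ e] conjI ballI impI \<open>0 < e\<close>)
      fix x y assume "x \<in> mspace (metric (topspace X, \<rho>))" "y \<in> mspace (metric (topspace X, \<rho>))"
        and "mdist (metric (topspace X, \<rho>)) y x < e"
      then show "mdist euclidean_metric (h y) (h x) < e"
        using lip[of x y] lip[of y x] commute[of x y] by (simp add: dist_real_def)
    qed
  qed simp
  then have "continuous_map X euclideanreal h"
    using uniformly_continuous_imp_continuous_map by (fastforce simp: topology_eq)
  moreover have "x \<in> C" if "x \<in> topspace X" "h x = 0" for x
  proof (rule ccontr)
    assume "x \<notin> C"
    then have "x \<in> topspace X - C" using that(1) by blast
    then obtain r where r: "0 < r" "disjnt C (mball x r)"
      using assms closedin_metric[of C] by (auto simp: topology_eq)
    have "r \<le> \<rho> x y" if "y \<in> C" for y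
      using r(2) that C \<open>x \<in> topspace X\<close> by (fastforce simp: disjnt_iff)
    then have "r \<le> h x"
      unfolding h_def using False by (intro cINF_greatest)
    with r(1) that(2) show False by simp
  qed
  moreover have "h x = 0" if "x \<in> C" for x
    using lower[OF that, of x] nonneg[of x] that C by auto
  ultimately show ?thesis
    using that nonneg by blast
qed

text \<open>The indicator of an open set is the increasing limit of \<open>min 1 (n * h)\<close>, where \<open>h \<ge> 0\<close> vanishes exactly
on the complement; and the open sets are a generator stable under intersections.\<close>

lemma measure_eq_of_integrals:
  assumes \<mu>: "prob_space \<mu>" "sets \<mu> = sets (borel_of X)"
    and \<nu>: "prob_space \<nu>" "sets \<nu> = sets (borel_of X)"
    and eq: "\<And>h. continuous_map X euclideanreal h \<Longrightarrow> integral\<^sup>L \<mu> h = integral\<^sup>L \<nu> h"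
  shows "\<mu> = \<nu>"
proof -
  have lim: "(\<lambda>n. integral\<^sup>L M (\<lambda>x. min 1 (real n * h x))) \<longlonglongrightarrow> measure M U"
    if M: "prob_space M" "sets M = sets (borel_of X)" and U: "openin X U"
      and h: "continuous_map X euclideanreal h" "\<And>x. x \<in> topspace X \<Longrightarrow> 0 \<le> h x"
        "\<And>x. x \<in> topspace X \<Longrightarrow> h x = 0 \<longleftrightarrow> x \<in> topspace X - U" for M h U
  proof -
    interpret prob_space M by fact
    have sp: "space M = topspace X" using sets_eq_imp_space_eq[OF M(2)] by simp
    have [measurable]: "h \<in> borel_measurable M"
      using continuous_map_borel_measurable[OF h(1)] M(2) measurable_cong_sets by blast
    have UM [measurable]: "U \<in> sets M"
      using U by (simp add: M(2) sets_borel_of sigma_sets.Basic)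
    have ptw: "(\<lambda>n. min 1 (real n * h x)) \<longlonglongrightarrow> indicat_real U x" if "x \<in> space M" for x
    proof (cases "x \<in> U")
      case True
      then have "0 < h x" using h(2,3)[of x] that sp by force
      then obtain n0 :: nat where n0: "1 < real n0 * h x"
        using reals_Archimedean3 by blast
      have "\<forall>\<^sub>F n in sequentially. min 1 (real n * h x) = 1"
        using eventually_ge_at_top[of n0]
      proof eventually_elim
        case (elim n)
        then have "real n0 * h x \<le> real n * h x"
          using \<open>0 < h x\<close> by (intro mult_right_mono) auto
        then show ?case using n0 by simp
      qed
      then show ?thesis using True by (simp add: tendsto_eventually)
    next
      case False
      then have "h x = 0" using h(3)[of x] that sp by simp
      then show ?thesis using False by simp
    qed
    have "(\<lambda>n. integral\<^sup>L M (\<lambda>x. min 1 (real n * h x))) \<longlonglongrightarrow> integral\<^sup>L M (indicat_real U)"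
      using ptw h(2) sp by (intro integral_dominated_convergence[where w = "\<lambda>_. 1"]) auto
    then show ?thesis using UM by simp
  qed
  have open_eq: "emeasure \<mu> U = emeasure \<nu> U" if U: "openin X U" for U
  proof -
    obtain h where h: "continuous_map X euclideanreal h" "\<And>x. x \<in> topspace X \<Longrightarrow> 0 \<le> h x"
        "\<And>x. x \<in> topspace X \<Longrightarrow> h x = 0 \<longleftrightarrow> x \<in> topspace X - U"
      using closed_zero_set[of "topspace X - U"] U by blast
    have "continuous_map X euclideanreal (\<lambda>x. min 1 (real n * h x))" for n
      using h(1) by (intro continuous_intros)
    then have "measure \<mu> U = measure \<nu> U"
      using lim[OF \<mu> U h] lim[OF \<nu> U h] eq by (auto intro: LIMSEQ_unique)
    then show ?thesis
      using \<mu>(1) \<nu>(1)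
      by (simp add: finite_measure.emeasure_eq_measure prob_space.finite_measure)
  qed
  show ?thesis
  proof (rule measure_eqI_generator_eq[where E = "{U. openin X U}" and A = "\<lambda>_. topspace X"
        and \<Omega> = "topspace X"])
    show "Int_stable {U. openin X U}" by (auto simp: Int_stable_def)
    show "{U. openin X U} \<subseteq> Pow (topspace X)" by (auto dest: openin_subset)
    show "emeasure \<mu> (topspace X) \<noteq> \<infinity>" for i :: nat
      using \<mu>(1) by (simp add: finite_measure.emeasure_finite prob_space.finite_measure)
  qed (use open_eq \<mu>(2) \<nu>(2) in \<open>auto simp: sets_borel_of\<close>)
qed

text \<open>A limit \<open>t\<close> of codes of points \<open>\<xi> n\<close> is decoded to a limit point of the \<open>\<xi> n\<close> in \<open>X\<close>.  Instead of
continuity of the decoder, only the equation \<open>h (g t) = H t\<close> is recorded, for every continuous \<open>h\<close>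
with extension \<open>H\<close>.  It gives measurability, because preimages of open sets are then described
by the vanishing of some \<open>H\<close>, and it computes all integrals that are needed.\<close>

lemma ex_decoder:
  assumes "topspace X \<noteq> {}"
  obtains g where "g \<in> measurable borel (borel_of X)"
    "\<And>h H t. continuous_map X euclideanreal h \<Longrightarrow> continuous_on UNIV H \<Longrightarrow>
       (\<And>x. x \<in> topspace X \<Longrightarrow> H (c x) = h x) \<Longrightarrow> t \<in> closure (c ` topspace X) \<Longrightarrow> h (g t) = H t"
proof -
  let ?K = "closure (c ` topspace X)"
  obtain x0 where x0: "x0 \<in> topspace X" using assms by blast
  have "\<exists>x\<in>topspace X. \<forall>h H. continuous_map X euclideanreal h \<longrightarrow> continuous_on UNIV H \<longrightarrow>
      (\<forall>x\<in>topspace X. H (c x) = h x) \<longrightarrow> h x = H t" if t: "t \<in> ?K" for t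
  proof -
    obtain s where s: "\<forall>n. s n \<in> c ` topspace X" "s \<longlonglongrightarrow> t"
      using t unfolding closure_sequential by blast
    then have "\<forall>n. \<exists>x\<in>topspace X. s n = c x" by blast
    then obtain \<xi> where \<xi>: "\<And>n. \<xi> n \<in> topspace X" "\<And>n. s n = c (\<xi> n)" by metis
    then have "range \<xi> \<subseteq> topspace X" by blast
    then obtain x r where x: "x \<in> topspace X" "strict_mono r" "limitin X (\<xi> \<circ> r) x sequentially"
      using compact compact_space_sequentially unfolding topology_eq by metis
    have "h x = H t" if h: "continuous_map X euclideanreal h" and H: "continuous_on UNIV H"
        "\<forall>x\<in>topspace X. H (c x) = h x" for h H
    proof (rule LIMSEQ_unique)
      show "(\<lambda>n. h (\<xi> (r n))) \<longlonglongrightarrow> h x"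
        using continuous_map_limit[OF h x(3)] by (simp add: o_def)
      have "(\<lambda>n. H (s (r n))) \<longlonglongrightarrow> H t"
        using continuous_on_tendsto_compose[OF H(1) LIMSEQ_subseq_LIMSEQ[OF s(2) x(2)]]
        by (simp add: o_def)
      then show "(\<lambda>n. h (\<xi> (r n))) \<longlonglongrightarrow> H t"
        using H(2) \<xi> by simp
    qed
    with x(1) show ?thesis by blast
  qed
  then obtain \<gamma> where \<gamma>: "\<And>t. t \<in> ?K \<Longrightarrow> \<gamma> t \<in> topspace X"
      "\<And>t h H. t \<in> ?K \<Longrightarrow> continuous_map X euclideanreal h \<Longrightarrow> continuous_on UNIV H \<Longrightarrow>
        \<forall>x\<in>topspace X. H (c x) = h x \<Longrightarrow> h (\<gamma> t) = H t"
    by metis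
  define g where "g t = (if t \<in> ?K then \<gamma> t else x0)" for t
  show thesis
  proof
    show "g \<in> measurable borel (borel_of X)"
    proof (rule borel_of_measurable)
      show "g \<in> space borel \<rightarrow> topspace X"
        using \<gamma>(1) x0 by (auto simp: g_def)
      fix U assume U: "openin X U"
      obtain h where h: "continuous_map X euclideanreal h"
          "\<And>x. x \<in> topspace X \<Longrightarrow> h x = 0 \<longleftrightarrow> x \<in> topspace X - U"
        using closed_zero_set[of "topspace X - U"] U by blast
      obtain H B where H: "continuous_on UNIV H" "\<And>t. \<bar>H t\<bar> \<le> B"
          "\<And>x. x \<in> topspace X \<Longrightarrow> H (c x) = h x"
        using continuous_function_factors[OF h(1)] by blast
      have "g t \<in> U \<longleftrightarrow> H t \<noteq> 0" if "t \<in> ?K" for t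
        using \<gamma>(1)[OF that] \<gamma>(2)[OF that h(1) H(1)] H(3) h(2)[of "\<gamma> t"] that by (auto simp: g_def)
      then have "g -` U \<inter> space borel = (?K \<inter> {t. H t \<noteq> 0}) \<union> (if x0 \<in> U then - ?K else {})"
        by (auto simp: g_def split: if_splits)
      moreover have [measurable]: "H \<in> borel_measurable borel"
        using H(1) by (rule borel_measurable_continuous_onI)
      have "{t. H t \<noteq> 0} \<in> sets borel" by measurable
      ultimately show "g -` U \<inter> space borel \<in> sets borel" by auto
    qed
  next
    fix h H t
    assume "continuous_map X euclideanreal h" "continuous_on UNIV H" "t \<in> ?K"
      and "\<And>x. x \<in> topspace X \<Longrightarrow> H (c x) = h x"
    then show "h (g t) = H t"
      using \<gamma>(2) by (simp add: g_def)
  qed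
qed

text \<open>Weak compactness of the probability measures on \<open>X\<close>, for empirical measures.  Their images under
the code are distributions on \<open>[0, 1]\<close>, so Helly's selection theorem provides a
subsequence that converges weakly to a distribution on the line.  The limit lives on the closure
of the set of codes, and the decoder carries it to \<open>X\<close>.\<close>

lemma empirical_subsequence_converges:
  fixes n :: "nat \<Rightarrow> nat"
  assumes n: "\<And>k. 0 < n k" and \<phi>: "\<And>k. \<phi> k \<in> {1..n k} \<rightarrow> topspace X"
  obtains r \<mu> where "strict_mono r" "prob_space \<mu>" "sets \<mu> = sets (borel_of X)"
    "\<And>h. continuous_map X euclideanreal h \<Longrightarrow>
       (\<lambda>k. emp_avg (n (r k)) (\<phi> (r k)) h) \<longlonglongrightarrow> integral\<^sup>L \<mu> h"
proof -
  let ?K = "closure (c ` topspace X)"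
  define D where "D k = distr (measure_pmf (pmf_of_set {1..n k})) borel (\<lambda>j. c (\<phi> k j))" for k
  have D: "real_distribution (D k)" for k
    unfolding D_def by (rule prob_space.real_distribution_distr) (auto intro: prob_space_measure_pmf)
  have intD: "integral\<^sup>L (D k) H = emp_avg (n k) (\<phi> k) (\<lambda>x. H (c x))"
    if "H \<in> borel_measurable borel" for H :: "real \<Rightarrow> real" and k
    unfolding D_def using that emp_avg_integral[OF n, of k "\<lambda>x. H (c x)" "\<phi> k"]
    by (simp add: integral_distr)
  have "tight D"
    unfolding tight_def
  proof (intro conjI allI impI D)
    fix e :: real assume "0 < e"
    have "measure (D k) {-1<..2} = 1" for k
    proof -
      have "-1 < c x \<and> c x \<le> 2" for x
        using code_range[of x] by simp
      then have "(\<lambda>j. c (\<phi> k j)) -` {-1<..2} = UNIV" by auto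
      then show ?thesis by (simp add: D_def measure_distr)
    qed
    then show "\<exists>a b. a < b \<and> (\<forall>k. 1 - e < measure (D k) {a<..b})"
      using \<open>0 < e\<close> by (intro exI[of _ "-1"] exI[of _ 2]) auto
  qed
  then obtain r M where r: "strict_mono r" and M: "real_distribution M" "weak_conv_m (D \<circ> id \<circ> r) M"
    using tight_imp_convergent_subsubsequence[of D id] by (auto simp: strict_mono_id)
  have conv: "(\<lambda>k. emp_avg (n (r k)) (\<phi> (r k)) (\<lambda>x. H (c x))) \<longlonglongrightarrow> integral\<^sup>L M H"
    if H: "continuous_on UNIV H" "\<And>t. \<bar>H t\<bar> \<le> B" for H B
  proof -
    have "(\<lambda>k. integral\<^sup>L ((D \<circ> id \<circ> r) k) H) \<longlonglongrightarrow> integral\<^sup>L M H"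
      using H D M by (intro weak_conv_imp_integral_bdd_continuous_conv)
        (auto simp: continuous_on_eq_continuous_at o_def)
    then show ?thesis
      using intD[OF borel_measurable_continuous_onI[OF H(1)]] by simp
  qed
  interpret M: real_distribution M by fact
  have "1 \<in> {1..n 0}" using n[of 0] by simp
  with \<phi>[of 0] have nonempty: "topspace X \<noteq> {}" by (metis empty_iff funcset_mem)
  \<comment> \<open>The truncated distance to \<open>?K\<close> is continuous and bounded and has integral \<open>0\<close> against every
    coded empirical measure, hence also against the limit.\<close>
  have supp: "AE t in M. t \<in> ?K"
  proof -
    let ?H = "\<lambda>t. min 1 (infdist t ?K)"
    have cont: "continuous_on UNIV ?H" by (intro continuous_intros)
    have bound: "\<bar>?H t\<bar> \<le> 1" for t
      using infdist_nonneg[of t ?K] by simp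
    have [measurable]: "?H \<in> borel_measurable borel"
      by (rule borel_measurable_continuous_onI[OF cont])
    have "emp_avg (n k) (\<phi> k) (\<lambda>x. ?H (c x)) = 0" for k
    proof -
      have "c (\<phi> k j) \<in> ?K" if "j \<in> {1..n k}" for j
        using funcset_mem[OF \<phi> that] closure_subset[of "c ` topspace X"] by blast
      then have "emp_avg (n k) (\<phi> k) (\<lambda>x. ?H (c x)) = 1 / real (n k) * (\<Sum>j=1..n k. 0)"
        unfolding emp_avg_def by (intro arg_cong2[where f = "(*)"] sum.cong) auto
      then show ?thesis by simp
    qed
    then have "integral\<^sup>L M ?H = 0"
      using conv[OF cont, of 1] bound by (simp add: LIMSEQ_const_iff)
    moreover have "integrable M ?H"
      using bound by (intro M.integrable_const_bound[of _ 1]) auto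
    ultimately have "AE t in M. ?H t = 0"
      using integral_nonneg_eq_0_iff_AE[of M ?H] infdist_nonneg by auto
    then show ?thesis
    proof eventually_elim
      case (elim t)
      then have "infdist t ?K = 0" by (simp add: min_def split: if_splits)
      then show ?case using nonempty in_closed_iff_infdist_zero[of ?K t] by simp
    qed
  qed
  obtain g where g: "g \<in> measurable borel (borel_of X)"
    "\<And>h H t. continuous_map X euclideanreal h \<Longrightarrow> continuous_on UNIV H \<Longrightarrow>
       (\<And>x. x \<in> topspace X \<Longrightarrow> H (c x) = h x) \<Longrightarrow> t \<in> ?K \<Longrightarrow> h (g t) = H t"
    using ex_decoder[OF nonempty] by blast
  have gM [measurable]: "g \<in> measurable M (borel_of X)"
    using g(1) by (simp cong: measurable_cong_sets)
  define \<mu> where "\<mu> = distr M (borel_of X) g"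
  show thesis
  proof
    show "strict_mono r" by (rule r)
    show "prob_space \<mu>" unfolding \<mu>_def by (rule M.prob_space_distr[OF gM])
    show "sets \<mu> = sets (borel_of X)" by (simp add: \<mu>_def)
    fix h assume h: "continuous_map X euclideanreal h"
    obtain H B where H: "continuous_on UNIV H" "\<And>t. \<bar>H t\<bar> \<le> B"
        "\<And>x. x \<in> topspace X \<Longrightarrow> H (c x) = h x"
      using continuous_function_factors[OF h] by blast
    have [measurable]: "h \<in> borel_measurable (borel_of X)" "H \<in> borel_measurable borel"
      using continuous_map_borel_measurable[OF h] borel_measurable_continuous_onI[OF H(1)] by auto
    have "integral\<^sup>L \<mu> h = integral\<^sup>L M (\<lambda>t. h (g t))"
      unfolding \<mu>_def by (rule integral_distr) measurable
    also have "\<dots> = integral\<^sup>L M H"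
    proof (rule integral_cong_AE)
      show "AE t in M. h (g t) = H t"
        using supp by eventually_elim (rule g(2)[OF h H(1,3)])
    qed measurable
    finally have "integral\<^sup>L \<mu> h = integral\<^sup>L M H" .
    moreover have "emp_avg (n k) (\<phi> k) (\<lambda>x. H (c x)) = emp_avg (n k) (\<phi> k) h" for k
      unfolding emp_avg_def using H(3) funcset_mem[OF \<phi>]
      by (intro arg_cong2[where f = "(*)"] sum.cong refl) blast
    ultimately show "(\<lambda>k. emp_avg (n (r k)) (\<phi> (r k)) h) \<longlonglongrightarrow> integral\<^sup>L \<mu> h"
      using conv[OF H(1,2)] by simp
  qed
qed

end

section \<open>Exponential growth rates\<close>

text \<open>With the next two lemmas, statements about \<open>limsup\<close> of \<open>1 / n * elog x\<close> become
statements about real inequalities \<open>exp (r * n) < x\<close> that hold for infinitely many indices.  All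
estimates below are carried out in this form, without logarithms or infinite values.\<close>

lemma less_elog_iff:
  assumes "0 < n"
  shows "ereal r < ereal (1 / real n) * elog x \<longleftrightarrow> ereal (exp (r * real n)) < x"
proof (cases x)
  case (real t)
  show ?thesis
  proof (cases "t \<le> 0")
    case True
    then show ?thesis
      using real assms exp_gt_zero[of "r * real n"] by (auto simp: elog_def not_less intro: order_trans)
  next
    case False
    then have "r < 1 / real n * ln t \<longleftrightarrow> r * real n < ln t"
      using assms by (simp add: field_simps)
    also have "\<dots> \<longleftrightarrow> exp (r * real n) < t"
      using False by (metis exp_less_cancel_iff exp_ln not_le)
    finally show ?thesis
      using False real by (simp add: elog_def)
  qed
qed (use assms in \<open>auto simp: elog_def\<close>)

lemma frequently_of_less_limsup:
  assumes "(x :: ereal) < limsup a"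
  shows "\<exists>\<^sub>F i in sequentially. x < a i"
proof (rule ccontr)
  assume "\<not> (\<exists>\<^sub>F i in sequentially. x < a i)"
  then have "\<forall>\<^sub>F i in sequentially. a i \<le> x"
    by (simp add: not_frequently not_less)
  then show False
    using assms Limsup_bounded[of a x sequentially] by (simp add: leD)
qed

lemma le_limsup_of_frequently:
  assumes "\<exists>\<^sub>F i in sequentially. (x :: ereal) < a i"
  shows "x \<le> limsup a"
proof (rule ccontr)
  assume "\<not> x \<le> limsup a"
  then have "\<forall>\<^sub>F i in sequentially. a i < x"
    by (intro Limsup_lessD) simp
  then have "\<forall>\<^sub>F i in sequentially. \<not> x < a i"
    by (rule eventually_mono) simp
  with assms show False
    by (simp add: frequently_def)
qed

lemma ereal_le_of_reals_below:
  assumes "\<And>r. ereal r < a \<Longrightarrow> ereal r \<le> b"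
  shows "a \<le> b"
proof (rule ccontr)
  assume "\<not> a \<le> b"
  then obtain r where "b < ereal r" "ereal r < a"
    using ereal_dense2[of b a] by (auto simp: not_le)
  with assms[of r] show False by simp
qed

lemma exists_heavy_fibre:
  fixes w :: "'y \<Rightarrow> real"
  assumes "finite E" "finite V" "g ` E \<subseteq> V" "0 < (\<Sum>\<phi>\<in>E. w \<phi>)"
  obtains v where "v \<in> V" "(\<Sum>\<phi>\<in>E. w \<phi>) \<le> real (card V) * (\<Sum>\<phi>\<in>{\<phi>\<in>E. g \<phi> = v}. w \<phi>)"
proof (rule ccontr)
  note witness = that
  assume "\<not> thesis"
  then have *: "real (card V) * (\<Sum>\<phi>\<in>{\<phi>\<in>E. g \<phi> = v}. w \<phi>) < (\<Sum>\<phi>\<in>E. w \<phi>)" if "v \<in> V" for v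
    using witness[OF that] by (meson not_less)
  have "V \<noteq> {}" using assms by auto
  have eq: "(\<Sum>\<phi>\<in>E. w \<phi>) = (\<Sum>v\<in>V. \<Sum>\<phi>\<in>{\<phi>\<in>E. g \<phi> = v}. w \<phi>)"
    using sum.group[OF assms(1,2,3), of w] by simp
  have "real (card V) * (\<Sum>\<phi>\<in>E. w \<phi>) = (\<Sum>v\<in>V. real (card V) * (\<Sum>\<phi>\<in>{\<phi>\<in>E. g \<phi> = v}. w \<phi>))"
    unfolding eq by (simp add: sum_distrib_left)
  also have "\<dots> < (\<Sum>v\<in>V. (\<Sum>\<phi>\<in>E. w \<phi>))"
    using * \<open>V \<noteq> {}\<close> assms(2) by (intro sum_strict_mono) auto
  finally show False by simp
qed

text \<open>The position of \<open>\<phi>\<close> in a grid of mesh \<open>\<eta>\<close>, where \<open>\<phi>\<close> has the averages of the functions in \<open>S\<close> as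
its coordinates.\<close>

definition grid_cell :: "real \<Rightarrow> ('x \<Rightarrow> real) set \<Rightarrow> nat \<Rightarrow> (nat \<Rightarrow> 'x) \<Rightarrow> ('x \<Rightarrow> real) \<Rightarrow> int" where
  "grid_cell \<eta> S n \<phi> = (\<lambda>u\<in>S. \<lfloor>emp_avg n \<phi> u / \<eta>\<rfloor>)"

lemma grid_cell_range:
  assumes "0 < \<eta>" "0 < n" "\<phi> \<in> {1..n} \<rightarrow> A" "\<And>u x. u \<in> S \<Longrightarrow> x \<in> A \<Longrightarrow> \<bar>u x\<bar> \<le> B"
  shows "grid_cell \<eta> S n \<phi> \<in> S \<rightarrow>\<^sub>E {\<lfloor>- B / \<eta>\<rfloor>..\<lfloor>B / \<eta>\<rfloor>}"
  unfolding grid_cell_def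
proof (intro restrict_PiE_iff[THEN iffD2] ballI)
  fix u assume "u \<in> S"
  then have "\<bar>emp_avg n \<phi> u\<bar> \<le> B"
    using assms(4) funcset_mem[OF assms(3)] by (intro emp_avg_abs_le[OF assms(2)]) blast
  then have "- B / \<eta> \<le> emp_avg n \<phi> u / \<eta>" "emp_avg n \<phi> u / \<eta> \<le> B / \<eta>"
    using assms(1) by (intro divide_right_mono; linarith)+
  then show "\<lfloor>emp_avg n \<phi> u / \<eta>\<rfloor> \<in> {\<lfloor>- B / \<eta>\<rfloor>..\<lfloor>B / \<eta>\<rfloor>}"
    by (simp add: floor_mono)
qed

lemma grid_cell_close:
  assumes "0 < \<eta>" "u \<in> S"
  shows "\<bar>emp_avg n \<phi> u - \<eta> * grid_cell \<eta> S n \<phi> u\<bar> \<le> \<eta>"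
proof -
  let ?q = "emp_avg n \<phi> u / \<eta>"
  have "\<bar>?q - \<lfloor>?q\<rfloor>\<bar> \<le> 1" by linarith
  then have "\<eta> * \<bar>?q - \<lfloor>?q\<rfloor>\<bar> \<le> \<eta>" using assms(1) by simp
  also have "\<eta> * \<bar>?q - \<lfloor>?q\<rfloor>\<bar> = \<bar>emp_avg n \<phi> u - \<eta> * \<lfloor>?q\<rfloor>\<bar>"
    using assms(1) abs_mult[of \<eta> "?q - \<lfloor>?q\<rfloor>"] by (simp add: right_diff_distrib)
  finally show ?thesis using assms(2) by (simp add: grid_cell_def)
qed

text \<open>The grid has a number of cells that does not depend on \<open>i\<close>.  Restricting a weighted family to its
heaviest cell therefore costs a constant factor, which is below \<open>exp (\<eta> * d i)\<close> as soon
as \<open>d i\<close> is large.  Since there are finitely many cells, the same cell is heaviest for infinitely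
many \<open>i\<close>.\<close>

lemma pigeonhole_averages:
  fixes d :: "nat \<Rightarrow> nat" and r \<eta> B :: real and w :: "nat \<Rightarrow> (nat \<Rightarrow> 'x) \<Rightarrow> real"
  assumes d: "\<And>i. 0 < d i" "filterlim d at_top sequentially"
    and S: "finite S" "\<And>u x. u \<in> S \<Longrightarrow> x \<in> A \<Longrightarrow> \<bar>u x\<bar> \<le> B"
    and \<eta>: "0 < \<eta>"
    and Q: "\<And>i E E'. Q i E \<Longrightarrow> E' \<subseteq> E \<Longrightarrow> Q i E'"
      "\<And>i E. Q i E \<Longrightarrow> finite E \<and> E \<subseteq> {1..d i} \<rightarrow> A"
    and large: "\<exists>\<^sub>F i in sequentially. \<exists>E. Q i E \<and> exp (r * d i) < (\<Sum>\<phi>\<in>E. w i \<phi>)"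
  obtains v where "\<exists>\<^sub>F i in sequentially. \<exists>E. Q i E \<and>
    (\<forall>\<phi>\<in>E. \<forall>u\<in>S. \<bar>emp_avg (d i) \<phi> u - v u\<bar> \<le> \<eta>) \<and> exp ((r - \<eta>) * d i) < (\<Sum>\<phi>\<in>E. w i \<phi>)"
proof -
  define V where "V = S \<rightarrow>\<^sub>E {\<lfloor>- B / \<eta>\<rfloor>..\<lfloor>B / \<eta>\<rfloor>}"
  have "finite V" unfolding V_def using S(1) by (intro finite_PiE) auto
  let ?good = "\<lambda>i v. \<exists>E. Q i E \<and>
    (\<forall>\<phi>\<in>E. \<forall>u\<in>S. \<bar>emp_avg (d i) \<phi> u - \<eta> * of_int (v u)\<bar> \<le> \<eta>) \<and>
    exp ((r - \<eta>) * d i) < (\<Sum>\<phi>\<in>E. w i \<phi>)"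
  have "filterlim (\<lambda>i. \<eta> * real (d i)) at_top sequentially"
    using \<eta> filterlim_compose[OF filterlim_real_sequentially d(2)]
    by (intro filterlim_tendsto_pos_mult_at_top[OF tendsto_const])
  then have "filterlim (\<lambda>i. exp (\<eta> * real (d i))) at_top sequentially"
    by (rule filterlim_compose[OF exp_at_top])
  then have "\<forall>\<^sub>F i in sequentially. real (card V) \<le> exp (\<eta> * real (d i))"
    by (simp add: filterlim_at_top)
  with large have "\<exists>\<^sub>F i in sequentially. (\<exists>E. Q i E \<and> exp (r * d i) < (\<Sum>\<phi>\<in>E. w i \<phi>)) \<and>
      real (card V) \<le> exp (\<eta> * real (d i))"
    by (rule frequently_eventually_frequently)
  then have "\<exists>\<^sub>F i in sequentially. \<exists>v\<in>V. ?good i v"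
  proof (rule frequently_elim1, clarify)
    fix i E assume E: "Q i E" "exp (r * d i) < (\<Sum>\<phi>\<in>E. w i \<phi>)"
      and card: "real (card V) \<le> exp (\<eta> * real (d i))"
    note fE = Q(2)[OF E(1)]
    have "0 < (\<Sum>\<phi>\<in>E. w i \<phi>)" using E(2) exp_gt_zero less_trans by blast
    moreover have "grid_cell \<eta> S (d i) \<phi> \<in> V" if "\<phi> \<in> E" for \<phi>
      unfolding V_def
      by (rule grid_cell_range[where A = A]) (use \<eta> d(1) S(2) fE that in blast)+
    then have "grid_cell \<eta> S (d i) ` E \<subseteq> V" by blast
    ultimately obtain v where v: "v \<in> V"
        "(\<Sum>\<phi>\<in>E. w i \<phi>) \<le> real (card V) * (\<Sum>\<phi>\<in>{\<phi>\<in>E. grid_cell \<eta> S (d i) \<phi> = v}. w i \<phi>)"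
      using exists_heavy_fibre[OF _ \<open>finite V\<close>] fE by blast
    let ?E = "{\<phi>\<in>E. grid_cell \<eta> S (d i) \<phi> = v}"
    have pos: "0 < (\<Sum>\<phi>\<in>?E. w i \<phi>)"
    proof (rule ccontr)
      assume "\<not> 0 < (\<Sum>\<phi>\<in>?E. w i \<phi>)"
      then have "real (card V) * (\<Sum>\<phi>\<in>?E. w i \<phi>) \<le> 0"
        by (intro mult_nonneg_nonpos) auto
      with v(2) \<open>0 < (\<Sum>\<phi>\<in>E. w i \<phi>)\<close> show False by linarith
    qed
    have "exp ((r - \<eta>) * d i) * exp (\<eta> * d i) = exp (r * d i)"
      by (simp add: exp_add[symmetric] algebra_simps)
    also have "\<dots> < real (card V) * (\<Sum>\<phi>\<in>?E. w i \<phi>)" using E(2) v(2) by linarith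
    also have "\<dots> \<le> (\<Sum>\<phi>\<in>?E. w i \<phi>) * exp (\<eta> * d i)"
      using card pos by (simp add: mult.commute)
    finally have "exp ((r - \<eta>) * d i) < (\<Sum>\<phi>\<in>?E. w i \<phi>)"
      by simp
    moreover have "Q i ?E" by (rule Q(1)[OF E(1)]) auto
    moreover have "\<forall>\<phi>\<in>?E. \<forall>u\<in>S. \<bar>emp_avg (d i) \<phi> u - \<eta> * of_int (v u)\<bar> \<le> \<eta>"
      using grid_cell_close[OF \<eta>] by auto
    ultimately show "\<exists>v\<in>V. ?good i v" using v(1) by blast
  qed
  from frequently_bex_finite[OF \<open>finite V\<close> this]
  obtain v where "\<exists>\<^sub>F i in sequentially. ?good i v" by blast
  then show thesis by (rule that[of "\<lambda>u. \<eta> * of_int (v u)"])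
qed

section \<open>Almost equivariant maps\<close>

text \<open>Averages do not change when the index set is permuted, so \<open>emp_avg n \<phi> h\<close> may be computed from
\<open>\<phi> \<circ> \<tau>\<close> instead of \<open>\<phi>\<close>, and \<open>rho2\<close> measures how far \<open>\<phi> \<circ> \<tau>\<close> is from \<open>T \<circ> \<phi>\<close> in the mean square.\<close>

lemma (in coded_compact_space) emp_avg_almost_invariant:
  assumes h: "continuous_map X euclideanreal h" and e: "0 < e"
  obtains C where "0 \<le> C"
    "\<And>n \<phi> T \<tau>. \<phi> \<in> {1..n} \<rightarrow> topspace X \<Longrightarrow> T \<in> topspace X \<rightarrow> topspace X \<Longrightarrow> \<tau> permutes {1..n} \<Longrightarrow>
       0 < n \<Longrightarrow>
       \<bar>emp_avg n \<phi> (\<lambda>x. h (T x)) - emp_avg n \<phi> h\<bar> \<le> e + C * (rho2 \<rho> n (T \<circ> \<phi>) (\<phi> \<circ> \<tau>))\<^sup>2"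
proof -
  obtain B where B: "0 < B" "\<And>x. x \<in> topspace X \<Longrightarrow> \<bar>h x\<bar> \<le> B"
    using continuous_function_bounded[OF h] by blast
  obtain \<theta> where \<theta>: "0 < \<theta>"
      "\<And>x y. x \<in> topspace X \<Longrightarrow> y \<in> topspace X \<Longrightarrow> \<rho> x y < \<theta> \<Longrightarrow> \<bar>h x - h y\<bar> < e"
    using continuous_function_uniform[OF h e] by blast
  define C where "C = 2 * B / \<theta>\<^sup>2"
  have "0 \<le> C" using B(1) by (simp add: C_def)
  \<comment> \<open>A quadratic modulus of continuity: either the points are closer than \<open>\<theta>\<close>, or the
    term \<open>C * (\<rho> x y)\<^sup>2\<close> is at least \<open>2 * B\<close>.  Its average over the index set is what \<open>rho2\<close> measures.\<close>
  have quad: "\<bar>h x - h y\<bar> \<le> e + C * (\<rho> x y)\<^sup>2" if "x \<in> topspace X" "y \<in> topspace X" for x y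
  proof (cases "\<rho> x y < \<theta>")
    case True
    moreover have "0 \<le> C * (\<rho> x y)\<^sup>2" using \<open>0 \<le> C\<close> by simp
    ultimately show ?thesis using \<theta>(2)[OF that True] by linarith
  next
    case False
    then have "2 * B * 1 \<le> 2 * B * ((\<rho> x y)\<^sup>2 / \<theta>\<^sup>2)"
      using B(1) \<theta>(1) by (intro mult_left_mono) (auto simp: power_mono)
    also have "\<dots> = C * (\<rho> x y)\<^sup>2" by (simp add: C_def)
    finally show ?thesis using B(2)[OF that(1)] B(2)[OF that(2)] e by linarith
  qed
  show thesis
  proof (rule that[OF \<open>0 \<le> C\<close>])
    fix n :: nat and \<phi> T \<tau>
    assume \<phi>: "\<phi> \<in> {1..n} \<rightarrow> topspace X" and T: "T \<in> topspace X \<rightarrow> topspace X"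
      and \<tau>: "\<tau> permutes {1..n}" and n: "0 < n"
    have "(\<Sum>j=1..n. h (\<phi> j)) = (\<Sum>j=1..n. h (\<phi> (\<tau> j)))"
      using sum.permute[OF \<tau>, of "\<lambda>j. h (\<phi> j)"] by (simp add: o_def)
    then have "emp_avg n \<phi> (\<lambda>x. h (T x)) - emp_avg n \<phi> h
        = 1 / real n * (\<Sum>j=1..n. h (T (\<phi> j)) - h (\<phi> (\<tau> j)))"
      by (simp add: emp_avg_def sum_subtractf right_diff_distrib diff_divide_distrib)
    also have "\<bar>\<dots>\<bar> \<le> 1 / real n * (\<Sum>j=1..n. \<bar>h (T (\<phi> j)) - h (\<phi> (\<tau> j))\<bar>)"
      unfolding abs_mult by (intro mult_mono) auto
    also have "\<dots> \<le> 1 / real n * (\<Sum>j=1..n. e + C * (\<rho> (T (\<phi> j)) (\<phi> (\<tau> j)))\<^sup>2)"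
    proof (intro mult_left_mono sum_mono quad)
      fix j assume "j \<in> {1..n}"
      moreover from this have "\<tau> j \<in> {1..n}" using permutes_in_image[OF \<tau>] by blast
      ultimately show "T (\<phi> j) \<in> topspace X" "\<phi> (\<tau> j) \<in> topspace X"
        using \<phi> T by blast+
    qed simp
    also have "\<dots> = e + C * (1 / real n * (\<Sum>j=1..n. (\<rho> (T (\<phi> j)) (\<phi> (\<tau> j)))\<^sup>2))"
      using n by (simp add: sum.distrib sum_distrib_left[symmetric] field_simps)
    also have "1 / real n * (\<Sum>j=1..n. (\<rho> (T (\<phi> j)) (\<phi> (\<tau> j)))\<^sup>2) = (rho2 \<rho> n (T \<circ> \<phi>) (\<phi> \<circ> \<tau>))\<^sup>2"
      by (simp add: rho2_def sum_nonneg)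
    finally show "\<bar>emp_avg n \<phi> (\<lambda>x. h (T x)) - emp_avg n \<phi> h\<bar>
        \<le> e + C * (rho2 \<rho> n (T \<circ> \<phi>) (\<phi> \<circ> \<tau>))\<^sup>2" .
  qed
qed

section \<open>The variational principle\<close>

locale coded_sofic_action = coded_compact_space X \<rho> c
  for X :: "'x topology" and \<rho> c +
  fixes G :: "('g, 'b) monoid_scheme" and d :: "nat \<Rightarrow> nat" and \<sigma> :: "nat \<Rightarrow> 'g \<Rightarrow> nat \<Rightarrow> nat"
    and \<alpha> :: "'g \<Rightarrow> 'x \<Rightarrow> 'x"
  assumes sofic: "sofic_group G"
    and approximation: "sofic_approximation G d \<sigma>"
    and action: "continuous_action G X \<alpha>"
begin

lemma d_pos: "0 < d i"
  using approximation by (simp add: sofic_approximation_def)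

lemma d_at_top: "filterlim d at_top sequentially"
  using approximation by (simp add: sofic_approximation_def)

lemma \<sigma>_permutes: "s \<in> carrier G \<Longrightarrow> \<sigma> i s permutes {1..d i}"
  using approximation by (simp add: sofic_approximation_def)

lemma \<alpha>_continuous: "s \<in> carrier G \<Longrightarrow> continuous_map X X (\<alpha> s)"
  using action by (simp add: continuous_action_def)

abbreviation separated_in :: "real \<Rightarrow> nat \<Rightarrow> (nat \<Rightarrow> 'x) set \<Rightarrow> (nat \<Rightarrow> 'x) set \<Rightarrow> bool" where
  "separated_in \<epsilon> i Y E \<equiv> finite E \<and> E \<subseteq> Y \<and> eps_separated (rho_inf \<rho> (d i)) \<epsilon> E"

lemma sofic_Map_funcset: "sofic_Map X \<alpha> \<rho> F \<delta> n \<tau> \<subseteq> {1..n} \<rightarrow> topspace X"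
  by (auto simp: sofic_Map_def)

text \<open>The pressure and the entropy are suprema over \<open>\<epsilon>\<close> of infima of upper limits.  The following four
lemmas pass between a real lower bound for such a quantity and the existence, for infinitely
many \<open>i\<close>, of large separated families; strict bounds are used, and weak bounds are produced.\<close>

lemma less_pressureE:
  fixes r :: real
  assumes "ereal r < sofic_pressure G d \<sigma> X \<alpha> \<rho> f"
  obtains \<epsilon> where "0 < \<epsilon>"
    "\<And>F \<delta>. F \<noteq> {} \<Longrightarrow> finite F \<Longrightarrow> F \<subseteq> carrier G \<Longrightarrow> 0 < \<delta> \<Longrightarrow>
       \<exists>\<^sub>F i in sequentially. \<exists>E. separated_in \<epsilon> i (sofic_Map X \<alpha> \<rho> F \<delta> (d i) (\<sigma> i)) E \<and>
         exp (r * d i) < (\<Sum>\<phi>\<in>E. exp (\<Sum>a=1..d i. f (\<phi> a)))"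
proof -
  obtain \<epsilon> where \<epsilon>: "0 < \<epsilon>" "ereal r < (INF F \<in> {F. F \<noteq> {} \<and> finite F \<and> F \<subseteq> carrier G}. INF \<delta> \<in> {0<..}.
        limsup (\<lambda>i. ereal (1 / real (d i)) * elog (sofic_M \<epsilon> f X \<alpha> \<rho> F \<delta> (d i) (\<sigma> i))))"
    using assms unfolding sofic_pressure_def less_SUP_iff by auto
  show thesis
  proof (rule that[OF \<epsilon>(1)])
    fix F and \<delta> :: real assume "F \<noteq> {}" "finite F" "F \<subseteq> carrier G" "0 < \<delta>"
    then have "ereal r < limsup (\<lambda>i. ereal (1 / real (d i)) * elog (sofic_M \<epsilon> f X \<alpha> \<rho> F \<delta> (d i) (\<sigma> i)))"
      using less_INF_D[OF less_INF_D[OF \<epsilon>(2), of F], of \<delta>] by simp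
    then have "\<exists>\<^sub>F i in sequentially. ereal r < ereal (1 / real (d i)) * elog (sofic_M \<epsilon> f X \<alpha> \<rho> F \<delta> (d i) (\<sigma> i))"
      by (rule frequently_of_less_limsup)
    then show "\<exists>\<^sub>F i in sequentially. \<exists>E. separated_in \<epsilon> i (sofic_Map X \<alpha> \<rho> F \<delta> (d i) (\<sigma> i)) E \<and>
         exp (r * d i) < (\<Sum>\<phi>\<in>E. exp (\<Sum>a=1..d i. f (\<phi> a)))"
      by (rule frequently_elim1) (auto simp: less_elog_iff[OF d_pos] sofic_M_def less_SUP_iff)
  qed
qed

lemma entropy_lower_bound:
  fixes r :: real
  assumes "0 < \<epsilon>"
    and "\<And>F L \<delta>. F \<noteq> {} \<Longrightarrow> finite F \<Longrightarrow> F \<subseteq> carrier G \<Longrightarrow> finite L \<Longrightarrow>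
       (\<And>g. g \<in> L \<Longrightarrow> continuous_map X euclideanreal g) \<Longrightarrow> 0 < \<delta> \<Longrightarrow>
       \<exists>\<^sub>F i in sequentially. \<exists>E.
         separated_in \<epsilon> i (sofic_Map_measure X \<alpha> \<mu> \<rho> F L \<delta> (d i) (\<sigma> i)) E \<and> exp (r * d i) < card E"
  shows "ereal r \<le> sofic_measure_entropy G d \<sigma> X \<alpha> \<rho> \<mu>"
  unfolding sofic_measure_entropy_def
proof (rule SUP_upper2[of \<epsilon>], use assms(1) in simp, intro INF_greatest)
  fix F :: "'g set" and L :: "('x \<Rightarrow> real) set" and \<delta> :: real
  assume "F \<in> {F. F \<noteq> {} \<and> finite F \<and> F \<subseteq> carrier G}"
    "L \<in> {L. L \<noteq> {} \<and> finite L \<and> (\<forall>g\<in>L. continuous_map X euclideanreal g)}" "\<delta> \<in> {0<..}"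
  then have "\<exists>\<^sub>F i in sequentially. \<exists>E.
         separated_in \<epsilon> i (sofic_Map_measure X \<alpha> \<mu> \<rho> F L \<delta> (d i) (\<sigma> i)) E \<and> exp (r * d i) < card E"
    by (intro assms(2)) auto
  then have "\<exists>\<^sub>F i in sequentially. ereal r < ereal (1 / real (d i)) *
      elog (sep_number \<epsilon> (sofic_Map_measure X \<alpha> \<mu> \<rho> F L \<delta> (d i) (\<sigma> i)) (rho_inf \<rho> (d i)))"
    by (rule frequently_elim1) (auto simp: less_elog_iff[OF d_pos] sep_number_def less_SUP_iff)
  then show "ereal r \<le> limsup (\<lambda>i. ereal (1 / real (d i)) *
      elog (sep_number \<epsilon> (sofic_Map_measure X \<alpha> \<mu> \<rho> F L \<delta> (d i) (\<sigma> i)) (rho_inf \<rho> (d i))))"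
    by (rule le_limsup_of_frequently)
qed

lemma less_entropyE:
  fixes r :: real
  assumes "ereal r < sofic_measure_entropy G d \<sigma> X \<alpha> \<rho> \<mu>"
  obtains \<epsilon> where "0 < \<epsilon>"
    "\<And>F L \<delta>. F \<noteq> {} \<Longrightarrow> finite F \<Longrightarrow> F \<subseteq> carrier G \<Longrightarrow> L \<noteq> {} \<Longrightarrow> finite L \<Longrightarrow>
       (\<And>g. g \<in> L \<Longrightarrow> continuous_map X euclideanreal g) \<Longrightarrow> 0 < \<delta> \<Longrightarrow>
       \<exists>\<^sub>F i in sequentially. \<exists>E.
         separated_in \<epsilon> i (sofic_Map_measure X \<alpha> \<mu> \<rho> F L \<delta> (d i) (\<sigma> i)) E \<and> exp (r * d i) < card E"
proof -
  obtain \<epsilon> where \<epsilon>: "0 < \<epsilon>" "ereal r < (INF F \<in> {F. F \<noteq> {} \<and> finite F \<and> F \<subseteq> carrier G}.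
      INF L \<in> {L. L \<noteq> {} \<and> finite L \<and> (\<forall>g\<in>L. continuous_map X euclideanreal g)}. INF \<delta> \<in> {0<..}.
        limsup (\<lambda>i. ereal (1 / real (d i)) *
          elog (sep_number \<epsilon> (sofic_Map_measure X \<alpha> \<mu> \<rho> F L \<delta> (d i) (\<sigma> i)) (rho_inf \<rho> (d i)))))"
    using assms unfolding sofic_measure_entropy_def less_SUP_iff by auto
  show thesis
  proof (rule that[OF \<epsilon>(1)])
    fix F L and \<delta> :: real
    assume "F \<noteq> {}" "finite F" "F \<subseteq> carrier G" "L \<noteq> {}" "finite L"
      "\<And>g. g \<in> L \<Longrightarrow> continuous_map X euclideanreal g" "0 < \<delta>"
    then have "ereal r < limsup (\<lambda>i. ereal (1 / real (d i)) *
          elog (sep_number \<epsilon> (sofic_Map_measure X \<alpha> \<mu> \<rho> F L \<delta> (d i) (\<sigma> i)) (rho_inf \<rho> (d i))))"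
      using less_INF_D[OF less_INF_D[OF less_INF_D[OF \<epsilon>(2), of F], of L], of \<delta>] by simp
    then have "\<exists>\<^sub>F i in sequentially. ereal r < ereal (1 / real (d i)) *
          elog (sep_number \<epsilon> (sofic_Map_measure X \<alpha> \<mu> \<rho> F L \<delta> (d i) (\<sigma> i)) (rho_inf \<rho> (d i)))"
      by (rule frequently_of_less_limsup)
    then show "\<exists>\<^sub>F i in sequentially. \<exists>E.
         separated_in \<epsilon> i (sofic_Map_measure X \<alpha> \<mu> \<rho> F L \<delta> (d i) (\<sigma> i)) E \<and> exp (r * d i) < card E"
      by (rule frequently_elim1) (auto simp: less_elog_iff[OF d_pos] sep_number_def less_SUP_iff)
  qed
qed

lemma pressure_lower_bound:
  fixes r :: real
  assumes "0 < \<epsilon>"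
    and "\<And>F \<delta>. F \<noteq> {} \<Longrightarrow> finite F \<Longrightarrow> F \<subseteq> carrier G \<Longrightarrow> 0 < \<delta> \<Longrightarrow>
       \<exists>\<^sub>F i in sequentially. \<exists>E. separated_in \<epsilon> i (sofic_Map X \<alpha> \<rho> F \<delta> (d i) (\<sigma> i)) E \<and>
         exp (r * d i) < (\<Sum>\<phi>\<in>E. exp (\<Sum>a=1..d i. f (\<phi> a)))"
  shows "ereal r \<le> sofic_pressure G d \<sigma> X \<alpha> \<rho> f"
  unfolding sofic_pressure_def
proof (rule SUP_upper2[of \<epsilon>], use assms(1) in simp, intro INF_greatest)
  fix F :: "'g set" and \<delta> :: real
  assume "F \<in> {F. F \<noteq> {} \<and> finite F \<and> F \<subseteq> carrier G}" "\<delta> \<in> {0<..}"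
  then have "\<exists>\<^sub>F i in sequentially. \<exists>E. separated_in \<epsilon> i (sofic_Map X \<alpha> \<rho> F \<delta> (d i) (\<sigma> i)) E \<and>
         exp (r * d i) < (\<Sum>\<phi>\<in>E. exp (\<Sum>a=1..d i. f (\<phi> a)))"
    by (intro assms(2)) auto
  then have "\<exists>\<^sub>F i in sequentially.
      ereal r < ereal (1 / real (d i)) * elog (sofic_M \<epsilon> f X \<alpha> \<rho> F \<delta> (d i) (\<sigma> i))"
    by (rule frequently_elim1) (auto simp: less_elog_iff[OF d_pos] sofic_M_def less_SUP_iff)
  then show "ereal r \<le> limsup (\<lambda>i. ereal (1 / real (d i)) * elog (sofic_M \<epsilon> f X \<alpha> \<rho> F \<delta> (d i) (\<sigma> i)))"
    by (rule le_limsup_of_frequently)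
qed

lemma sum_eq_emp_avg: "(\<Sum>a=1..d i. f (\<phi> a)) = emp_avg (d i) \<phi> f * d i"
  using d_pos[of i] by (simp add: emp_avg_def)

text \<open>Take \<open>f\<close> itself as the only test function.  Then every \<open>\<phi>\<close> in a separated family that counts for the
entropy satisfies \<open>\<Sum>a. f (\<phi> a) \<ge> d i * (\<integral>f d\<mu> - \<kappa>)\<close>, so the family has weight at least its
cardinality times \<open>exp (d i * (\<integral>f d\<mu> - \<kappa>))\<close>.\<close>

lemma entropy_plus_integral_le_pressure:
  assumes f: "continuous_map X euclideanreal f"
  shows "sofic_measure_entropy G d \<sigma> X \<alpha> \<rho> \<mu> + ereal (integral\<^sup>L \<mu> f) \<le> sofic_pressure G d \<sigma> X \<alpha> \<rho> f"
proof -
  let ?I = "integral\<^sup>L \<mu> f"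
  have step: "ereal (r + ?I - \<kappa>) \<le> sofic_pressure G d \<sigma> X \<alpha> \<rho> f"
    if r: "ereal r < sofic_measure_entropy G d \<sigma> X \<alpha> \<rho> \<mu>" and \<kappa>: "0 < \<kappa>" for r \<kappa>
  proof -
    obtain \<epsilon> where \<epsilon>: "0 < \<epsilon>"
      "\<And>F L \<delta>. F \<noteq> {} \<Longrightarrow> finite F \<Longrightarrow> F \<subseteq> carrier G \<Longrightarrow> L \<noteq> {} \<Longrightarrow> finite L \<Longrightarrow>
       (\<And>g. g \<in> L \<Longrightarrow> continuous_map X euclideanreal g) \<Longrightarrow> 0 < \<delta> \<Longrightarrow>
       \<exists>\<^sub>F i in sequentially. \<exists>E.
         separated_in \<epsilon> i (sofic_Map_measure X \<alpha> \<mu> \<rho> F L \<delta> (d i) (\<sigma> i)) E \<and> exp (r * d i) < card E"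
      using less_entropyE[OF r] by blast
    show ?thesis
    proof (rule pressure_lower_bound[OF \<epsilon>(1)])
      fix F and \<delta> :: real assume F: "F \<noteq> {}" "finite F" "F \<subseteq> carrier G" "0 < \<delta>"
      have "\<exists>\<^sub>F i in sequentially. \<exists>E.
          separated_in \<epsilon> i (sofic_Map_measure X \<alpha> \<mu> \<rho> F {f} (min \<delta> \<kappa>) (d i) (\<sigma> i)) E \<and> exp (r * d i) < card E"
        using F f \<kappa> by (intro \<epsilon>(2)) auto
      then show "\<exists>\<^sub>F i in sequentially. \<exists>E. separated_in \<epsilon> i (sofic_Map X \<alpha> \<rho> F \<delta> (d i) (\<sigma> i)) E \<and>
         exp ((r + ?I - \<kappa>) * d i) < (\<Sum>\<phi>\<in>E. exp (\<Sum>a=1..d i. f (\<phi> a)))"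
      proof (rule frequently_elim1, clarify)
        fix i E
        assume E: "finite E" "E \<subseteq> sofic_Map_measure X \<alpha> \<mu> \<rho> F {f} (min \<delta> \<kappa>) (d i) (\<sigma> i)"
          "eps_separated (rho_inf \<rho> (d i)) \<epsilon> E" and card: "exp (r * d i) < card E"
        have "E \<subseteq> sofic_Map X \<alpha> \<rho> F \<delta> (d i) (\<sigma> i)"
          using E(2) by (auto simp: sofic_Map_measure_def sofic_Map_def)
        moreover have "exp ((r + ?I - \<kappa>) * d i) < (\<Sum>\<phi>\<in>E. exp (\<Sum>a=1..d i. f (\<phi> a)))"
        proof -
          have "exp ((?I - \<kappa>) * d i) \<le> exp (\<Sum>a=1..d i. f (\<phi> a))" if "\<phi> \<in> E" for \<phi>
          proof -
            have "\<bar>emp_avg (d i) \<phi> f - ?I\<bar> < \<kappa>"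
              using E(2) that by (force simp: sofic_Map_measure_def emp_avg_def)
            then have "?I - \<kappa> \<le> emp_avg (d i) \<phi> f" by linarith
            then show ?thesis unfolding sum_eq_emp_avg by (simp add: mult_right_mono)
          qed
          then have "real (card E) * exp ((?I - \<kappa>) * d i) \<le> (\<Sum>\<phi>\<in>E. exp (\<Sum>a=1..d i. f (\<phi> a)))"
            by (rule sum_bounded_below)
          moreover have "exp (r * d i) * exp ((?I - \<kappa>) * d i) < card E * exp ((?I - \<kappa>) * d i)"
            using card by simp
          moreover have "exp ((r + ?I - \<kappa>) * d i) = exp (r * d i) * exp ((?I - \<kappa>) * d i)"
            by (simp add: exp_add[symmetric] algebra_simps)
          ultimately show ?thesis by linarith
        qed
        ultimately show "\<exists>E. separated_in \<epsilon> i (sofic_Map X \<alpha> \<rho> F \<delta> (d i) (\<sigma> i)) E \<and>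
            exp ((r + ?I - \<kappa>) * d i) < (\<Sum>\<phi>\<in>E. exp (\<Sum>a=1..d i. f (\<phi> a)))"
          using E(1,3) by blast
      qed
    qed
  qed
  have "ereal r \<le> sofic_pressure G d \<sigma> X \<alpha> \<rho> f - ereal ?I"
    if "ereal r < sofic_measure_entropy G d \<sigma> X \<alpha> \<rho> \<mu>" for r
  proof -
    have "ereal (r + ?I) \<le> sofic_pressure G d \<sigma> X \<alpha> \<rho> f"
    proof (rule ereal_le_epsilon2)
      fix \<kappa> :: real assume "0 < \<kappa>"
      then show "ereal (r + ?I) \<le> sofic_pressure G d \<sigma> X \<alpha> \<rho> f + ereal \<kappa>"
        using step[OF that \<open>0 < \<kappa>\<close>] by (cases "sofic_pressure G d \<sigma> X \<alpha> \<rho> f") auto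
    qed
    then show ?thesis by (cases "sofic_pressure G d \<sigma> X \<alpha> \<rho> f") auto
  qed
  then have "sofic_measure_entropy G d \<sigma> X \<alpha> \<rho> \<mu> \<le> sofic_pressure G d \<sigma> X \<alpha> \<rho> f - ereal ?I"
    by (rule ereal_le_of_reals_below)
  then show ?thesis
    by (cases "sofic_pressure G d \<sigma> X \<alpha> \<rho> f"; cases "sofic_measure_entropy G d \<sigma> X \<alpha> \<rho> \<mu>") auto
qed

text \<open>For every \<open>n\<close> the pigeonhole principle selects, inside the almost equivariant maps of
quality \<open>n\<close>, heavy families whose members agree up to \<open>\<eta> n\<close> in their averages of \<open>f\<close> and of the
\<open>n\<close>-th Bernstein window.  A single member \<open>\<phi> n\<close> serves to represent them, and \<open>\<mu>\<close> is
a weak limit of the empirical measures of the \<open>\<phi> n\<close>.  It is invariant because \<open>\<phi> n\<close> is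
more and more equivariant.  Given a finite set of test functions, the selected families
for a suitable \<open>n\<close> consist of maps that are almost distributed according to \<open>\<mu>\<close>; as the
sums of \<open>f\<close> are nearly constant on them, their weight bounds their cardinality from below.\<close>

lemma exists_measure_of_less_pressure:
  assumes f: "continuous_map X euclideanreal f"
    and r: "ereal r < sofic_pressure G d \<sigma> X \<alpha> \<rho> f"
  shows "\<exists>\<mu>\<in>invariant_measures G X \<alpha>.
    ereal r \<le> sofic_measure_entropy G d \<sigma> X \<alpha> \<rho> \<mu> + ereal (integral\<^sup>L \<mu> f)"
proof -
  obtain \<epsilon> where \<epsilon>: "0 < \<epsilon>"
    "\<And>F \<delta>. F \<noteq> {} \<Longrightarrow> finite F \<Longrightarrow> F \<subseteq> carrier G \<Longrightarrow> 0 < \<delta> \<Longrightarrow>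
       \<exists>\<^sub>F i in sequentially. \<exists>E. separated_in \<epsilon> i (sofic_Map X \<alpha> \<rho> F \<delta> (d i) (\<sigma> i)) E \<and>
         exp (r * d i) < (\<Sum>\<phi>\<in>E. exp (\<Sum>a=1..d i. f (\<phi> a)))"
    using less_pressureE[OF r] by blast
  obtain B where B: "\<And>x. x \<in> topspace X \<Longrightarrow> \<bar>f x\<bar> \<le> B"
    using continuous_function_bounded[OF f] by blast
  have carrier: "carrier G \<noteq> {}" "countable (carrier G)"
    using sofic group.is_monoid monoid.one_closed unfolding sofic_group_def by blast+
  define F where "F n = from_nat_into (carrier G) ` {..n}" for n :: nat
  have F: "F n \<noteq> {}" "finite (F n)" "F n \<subseteq> carrier G" for n
    using from_nat_into[OF carrier(1)] by (auto simp: F_def)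
  have F_exhausts: "\<forall>\<^sub>F n in sequentially. s \<in> F n" if s: "s \<in> carrier G" for s
  proof -
    obtain m where "from_nat_into (carrier G) m = s"
      using from_nat_into_surj[OF carrier(2) s] by blast
    then have "\<forall>n\<ge>m. s \<in> F n" by (auto simp: F_def)
    then show ?thesis by (auto simp: eventually_sequentially)
  qed
  define \<eta> where "\<eta> n = 1 / real (Suc n)" for n
  have \<eta>: "0 < \<eta> n" for n by (simp add: \<eta>_def)
  have \<eta>_lim: "\<eta> \<longlonglongrightarrow> 0"
    unfolding \<eta>_def by (rule LIMSEQ_inverse_real_of_nat[unfolded inverse_eq_divide])
  define Y where "Y n i = sofic_Map X \<alpha> \<rho> (F n) (\<eta> n) (d i) (\<sigma> i)" for n i
  define S where "S n = insert f (Bernstein_window c n)" for n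
  define good where "good n v i E \<longleftrightarrow> separated_in \<epsilon> i (Y n i) E \<and>
      (\<forall>\<phi>\<in>E. \<forall>u\<in>S n. \<bar>emp_avg (d i) \<phi> u - v u\<bar> \<le> \<eta> n) \<and>
      exp ((r - \<eta> n) * d i) < (\<Sum>\<phi>\<in>E. exp (\<Sum>a=1..d i. f (\<phi> a)))" for n v i E
  \<comment> \<open>The set of prescribed averages \<open>v\<close> may depend on \<open>n\<close>, but not on \<open>i\<close>.\<close>
  have "\<exists>v. \<exists>\<^sub>F i in sequentially. \<exists>E. good n v i E" for n
  proof -
    have bound: "\<bar>u x\<bar> \<le> max 1 B" if "u \<in> S n" "x \<in> topspace X" for u x
      using that B[OF that(2)] Bernstein_window_bounded[of u n x] by (force simp: S_def)
    obtain v where "\<exists>\<^sub>F i in sequentially. \<exists>E. separated_in \<epsilon> i (Y n i) E \<and>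
        (\<forall>\<phi>\<in>E. \<forall>u\<in>S n. \<bar>emp_avg (d i) \<phi> u - v u\<bar> \<le> \<eta> n) \<and>
        exp ((r - \<eta> n) * d i) < (\<Sum>\<phi>\<in>E. exp (\<Sum>a=1..d i. f (\<phi> a)))"
    proof (rule pigeonhole_averages[where d = d and S = "S n" and A = "topspace X" and B = "max 1 B"
          and \<eta> = "\<eta> n" and r = r and Q = "\<lambda>i E. separated_in \<epsilon> i (Y n i) E"
          and w = "\<lambda>i \<phi>. exp (\<Sum>a=1..d i. f (\<phi> a))"])
      show "finite (S n)" by (simp add: S_def finite_Bernstein_window)
      show "separated_in \<epsilon> i (Y n i) E'" if "separated_in \<epsilon> i (Y n i) E" "E' \<subseteq> E" for i E E'
        using that by (auto simp: eps_separated_def intro: finite_subset)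
      show "finite E \<and> E \<subseteq> {1..d i} \<rightarrow> topspace X" if "separated_in \<epsilon> i (Y n i) E" for i E
        using that sofic_Map_funcset unfolding Y_def by blast
      show "\<exists>\<^sub>F i in sequentially. \<exists>E. separated_in \<epsilon> i (Y n i) E \<and>
          exp (r * d i) < (\<Sum>\<phi>\<in>E. exp (\<Sum>a=1..d i. f (\<phi> a)))"
        unfolding Y_def using F \<eta> by (intro \<epsilon>(2))
    qed (use d_pos d_at_top bound \<eta> in blast)+
    then show ?thesis unfolding good_def by blast
  qed
  then obtain v where v: "\<And>n. \<exists>\<^sub>F i in sequentially. \<exists>E. good n (v n) i E" by metis
  have "\<exists>i E \<phi>. good n (v n) i E \<and> \<phi> \<in> E" for n
  proof -
    obtain i E where "good n (v n) i E"
      using frequently_ex[OF v[of n]] by blast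
    moreover from this have "E \<noteq> {}"
      unfolding good_def using exp_gt_zero[of "(r - \<eta> n) * d i"] by auto
    ultimately show ?thesis by blast
  qed
  then obtain i E \<phi> where \<phi>: "\<And>n. good n (v n) (i n) (E n)" "\<And>n. \<phi> n \<in> E n" by metis
  have \<phi>Y: "\<phi> n \<in> Y n (i n)" for n using \<phi>[of n] by (auto simp: good_def)
  have \<phi>X: "\<phi> n \<in> {1..d (i n)} \<rightarrow> topspace X" for n
    using \<phi>Y[of n] sofic_Map_funcset unfolding Y_def by blast
  obtain k \<mu> where k: "strict_mono k" and \<mu>: "prob_space \<mu>" "sets \<mu> = sets (borel_of X)"
    and lim: "\<And>h. continuous_map X euclideanreal h \<Longrightarrow>
       (\<lambda>m. emp_avg (d (i (k m))) (\<phi> (k m)) h) \<longlonglongrightarrow> integral\<^sup>L \<mu> h"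
    using empirical_subsequence_converges[of "\<lambda>n. d (i n)" \<phi>, OF d_pos \<phi>X] by blast
  have evk: "\<forall>\<^sub>F m in sequentially. P (k m)" if "eventually P sequentially" for P
    using eventually_subseq[OF k that] .
  have ev\<eta>: "\<forall>\<^sub>F n in sequentially. \<eta> n < e" if "0 < e" for e
    using order_tendstoD(2)[OF \<eta>_lim that] .

  have invariant: "distr \<mu> (borel_of X) (\<alpha> s) = \<mu>" if s: "s \<in> carrier G" for s
  proof (rule measure_eq_of_integrals[OF _ _ \<mu>])
    note cont = \<alpha>_continuous[OF s]
    have meas: "\<alpha> s \<in> measurable \<mu> (borel_of X)"
      using continuous_map_measurable_borel_of[OF cont] \<mu>(2) measurable_cong_sets by blast
    show "prob_space (distr \<mu> (borel_of X) (\<alpha> s))"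
      by (rule prob_space.prob_space_distr[OF \<mu>(1) meas])
    show "sets (distr \<mu> (borel_of X) (\<alpha> s)) = sets (borel_of X)" by simp
    fix h assume h: "continuous_map X euclideanreal h"
    have hs: "continuous_map X euclideanreal (\<lambda>x. h (\<alpha> s x))"
      using continuous_map_compose[OF cont h] by (simp add: o_def)
    have "\<bar>integral\<^sup>L \<mu> (\<lambda>x. h (\<alpha> s x)) - integral\<^sup>L \<mu> h\<bar> \<le> e" if "0 < e" for e
    proof -
      obtain C where C: "0 \<le> C"
        "\<And>n \<phi> T \<tau>. \<phi> \<in> {1..n} \<rightarrow> topspace X \<Longrightarrow> T \<in> topspace X \<rightarrow> topspace X \<Longrightarrow>
           \<tau> permutes {1..n} \<Longrightarrow> 0 < n \<Longrightarrow>
           \<bar>emp_avg n \<phi> (\<lambda>x. h (T x)) - emp_avg n \<phi> h\<bar> \<le> e + C * (rho2 \<rho> n (T \<circ> \<phi>) (\<phi> \<circ> \<tau>))\<^sup>2"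
        using emp_avg_almost_invariant[OF h \<open>0 < e\<close>] by blast
      have "\<forall>\<^sub>F n in sequentially.
          \<bar>emp_avg (d (i n)) (\<phi> n) (\<lambda>x. h (\<alpha> s x)) - emp_avg (d (i n)) (\<phi> n) h\<bar> \<le> e + C * (\<eta> n)\<^sup>2"
        using F_exhausts[OF s]
      proof eventually_elim
        case (elim n)
        let ?q = "rho2 \<rho> (d (i n)) (\<alpha> s \<circ> \<phi> n) (\<phi> n \<circ> \<sigma> (i n) s)"
        have "?q < \<eta> n" using \<phi>Y[of n] elim by (simp add: Y_def sofic_Map_def)
        moreover have "0 \<le> ?q" by (simp add: rho2_def sum_nonneg)
        ultimately have "C * ?q\<^sup>2 \<le> C * (\<eta> n)\<^sup>2"
          using C(1) by (intro mult_left_mono power_mono) auto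
        then show ?case
          using C(2)[OF \<phi>X continuous_map_funspace[OF cont] \<sigma>_permutes[OF s] d_pos, of n]
          by linarith
      qed
      then have "\<forall>\<^sub>F m in sequentially.
          \<bar>emp_avg (d (i (k m))) (\<phi> (k m)) (\<lambda>x. h (\<alpha> s x)) - emp_avg (d (i (k m))) (\<phi> (k m)) h\<bar>
            \<le> e + C * (\<eta> (k m))\<^sup>2"
        by (rule evk)
      moreover have "(\<lambda>m. \<bar>emp_avg (d (i (k m))) (\<phi> (k m)) (\<lambda>x. h (\<alpha> s x)) - emp_avg (d (i (k m))) (\<phi> (k m)) h\<bar>)
          \<longlonglongrightarrow> \<bar>integral\<^sup>L \<mu> (\<lambda>x. h (\<alpha> s x)) - integral\<^sup>L \<mu> h\<bar>"
        by (intro tendsto_rabs tendsto_diff lim h hs)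
      moreover have "(\<lambda>m. e + C * (\<eta> (k m))\<^sup>2) \<longlonglongrightarrow> e + C * 0\<^sup>2"
        using LIMSEQ_subseq_LIMSEQ[OF \<eta>_lim k] by (intro tendsto_intros) (simp add: o_def)
      ultimately show ?thesis
        using tendsto_le[OF sequentially_bot] by fastforce
    qed
    then have "\<bar>integral\<^sup>L \<mu> (\<lambda>x. h (\<alpha> s x)) - integral\<^sup>L \<mu> h\<bar> \<le> 0"
      by (rule field_le_epsilon[of _ 0, simplified])
    moreover have "integral\<^sup>L (distr \<mu> (borel_of X) (\<alpha> s)) h = integral\<^sup>L \<mu> (\<lambda>x. h (\<alpha> s x))"
      by (rule integral_distr[OF meas continuous_map_borel_measurable[OF h]])
    ultimately show "integral\<^sup>L (distr \<mu> (borel_of X) (\<alpha> s)) h = integral\<^sup>L \<mu> h" by simp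
  qed

  let ?I = "integral\<^sup>L \<mu> f"
  have entropy: "ereal (r - ?I - \<kappa>) \<le> sofic_measure_entropy G d \<sigma> X \<alpha> \<rho> \<mu>" if \<kappa>: "0 < \<kappa>" for \<kappa>
  proof (rule entropy_lower_bound[OF \<epsilon>(1)])
    fix F' L and \<delta> :: real
    assume F': "F' \<noteq> {}" "finite F'" "F' \<subseteq> carrier G" and L: "finite L"
      "\<And>g. g \<in> L \<Longrightarrow> continuous_map X euclideanreal g" and \<delta>: "0 < \<delta>"
    \<comment> \<open>For late \<open>n\<close>, any two maps with averages near \<open>v n\<close> have nearly the same average of \<open>g\<close>; this is
      applied to a member of a selected family and to \<open>\<phi> n\<close>, whose index \<open>i n\<close> may differ.\<close>
    define determined where "determined g n \<longleftrightarrow> (\<forall>j \<psi> j' \<psi>'.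
        \<psi> \<in> {1..d j} \<rightarrow> topspace X \<longrightarrow> \<psi>' \<in> {1..d j'} \<rightarrow> topspace X \<longrightarrow>
        (\<forall>u\<in>S n. \<bar>emp_avg (d j) \<psi> u - v n u\<bar> \<le> \<eta> n) \<longrightarrow>
        (\<forall>u\<in>S n. \<bar>emp_avg (d j') \<psi>' u - v n u\<bar> \<le> \<eta> n) \<longrightarrow>
        \<bar>emp_avg (d j) \<psi> g - emp_avg (d j') \<psi>' g\<bar> < \<delta> / 2)" for g n
    have determine: "\<forall>\<^sub>F n in sequentially. determined g n" if g: "g \<in> L" for g
    proof -
      obtain N \<theta> where \<theta>: "0 < \<theta>"
        "\<And>n n' \<phi> \<phi>'. 0 < n \<Longrightarrow> 0 < n' \<Longrightarrow> \<phi> \<in> {1..n} \<rightarrow> topspace X \<Longrightarrow> \<phi>' \<in> {1..n'} \<rightarrow> topspace X \<Longrightarrow>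
           (\<And>u. u \<in> Bernstein_window c N \<Longrightarrow> \<bar>emp_avg n \<phi> u - emp_avg n' \<phi>' u\<bar> \<le> \<theta>) \<Longrightarrow>
           \<bar>emp_avg n \<phi> g - emp_avg n' \<phi>' g\<bar> < \<delta> / 2"
        using Bernstein_window_determines[OF L(2)[OF g], of "\<delta> / 2"] \<delta> by (metis half_gt_zero)
      have "0 < \<theta> / 2" using \<theta>(1) by simp
      show ?thesis
        using ev\<eta>[OF \<open>0 < \<theta> / 2\<close>] eventually_ge_at_top[of N]
      proof eventually_elim
        case (elim n)
        have "Bernstein_window c N \<subseteq> S n"
          using elim(2) by (fastforce simp: S_def Bernstein_window_def)
        show ?case
          unfolding determined_def
        proof (intro allI impI)
          fix j \<psi> j' \<psi>'
          assume "\<psi> \<in> {1..d j} \<rightarrow> topspace X" "\<psi>' \<in> {1..d j'} \<rightarrow> topspace X"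
            and close: "\<forall>u\<in>S n. \<bar>emp_avg (d j) \<psi> u - v n u\<bar> \<le> \<eta> n"
              "\<forall>u\<in>S n. \<bar>emp_avg (d j') \<psi>' u - v n u\<bar> \<le> \<eta> n"
          then show "\<bar>emp_avg (d j) \<psi> g - emp_avg (d j') \<psi>' g\<bar> < \<delta> / 2"
          proof (intro \<theta>(2) d_pos)
            fix u assume "u \<in> Bernstein_window c N"
            then have "u \<in> S n" using \<open>Bernstein_window c N \<subseteq> S n\<close> by blast
            then show "\<bar>emp_avg (d j) \<psi> u - emp_avg (d j') \<psi>' u\<bar> \<le> \<theta>"
              using close[THEN bspec, of u] elim(1) by linarith
          qed
        qed
      qed
    qed
    have near: "\<forall>\<^sub>F m in sequentially. \<bar>emp_avg (d (i (k m))) (\<phi> (k m)) g - integral\<^sup>L \<mu> g\<bar> < e"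
      if "continuous_map X euclideanreal g" "0 < e" for g e
      using tendstoD[OF lim[OF that(1)] that(2)] by (simp add: dist_real_def)
    have "\<forall>\<^sub>F m in sequentially. F' \<subseteq> F (k m)"
      using F' F_exhausts by (intro evk) (auto simp: subset_eq intro!: eventually_ball_finite)
    \<comment> \<open>The final estimate loses \<open>\<kappa> / 2 + 3 * \<eta> n\<close>: one \<open>\<eta> n\<close> from the pigeonhole principle and two
      from passing from \<open>f\<close>-averages of maps to \<open>v n f\<close> and from there to \<open>\<phi> n\<close>.\<close>
    moreover have "\<forall>\<^sub>F m in sequentially. \<eta> (k m) < min \<delta> (\<kappa> / 6)"
      using \<delta> \<kappa> by (intro evk ev\<eta>) simp
    moreover have "\<forall>\<^sub>F m in sequentially. \<bar>emp_avg (d (i (k m))) (\<phi> (k m)) f - ?I\<bar> < \<kappa> / 2"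
      using \<kappa> by (intro near f) simp
    moreover have "\<forall>\<^sub>F m in sequentially. \<forall>g\<in>L. \<bar>emp_avg (d (i (k m))) (\<phi> (k m)) g - integral\<^sup>L \<mu> g\<bar> < \<delta> / 2"
      using \<delta> L by (intro eventually_ball_finite ballI near) auto
    moreover have "\<forall>\<^sub>F m in sequentially. \<forall>g\<in>L. determined g (k m)"
      using L(1) evk[OF determine] by (intro eventually_ball_finite ballI)
    ultimately have "\<forall>\<^sub>F m in sequentially. F' \<subseteq> F (k m) \<and> \<eta> (k m) < min \<delta> (\<kappa> / 6) \<and>
        \<bar>emp_avg (d (i (k m))) (\<phi> (k m)) f - ?I\<bar> < \<kappa> / 2 \<and>
        (\<forall>g\<in>L. \<bar>emp_avg (d (i (k m))) (\<phi> (k m)) g - integral\<^sup>L \<mu> g\<bar> < \<delta> / 2) \<and>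
        (\<forall>g\<in>L. determined g (k m))"
      by (intro eventually_conj)
    from eventually_happens'[OF sequentially_bot this]
    obtain n where n: "F' \<subseteq> F n" "\<eta> n < min \<delta> (\<kappa> / 6)"
        "\<bar>emp_avg (d (i n)) (\<phi> n) f - ?I\<bar> < \<kappa> / 2"
        "\<And>g. g \<in> L \<Longrightarrow> \<bar>emp_avg (d (i n)) (\<phi> n) g - integral\<^sup>L \<mu> g\<bar> < \<delta> / 2"
      and determined: "\<And>g. g \<in> L \<Longrightarrow> determined g n"
      by blast
    have \<phi>v: "\<forall>u\<in>S n. \<bar>emp_avg (d (i n)) (\<phi> n) u - v n u\<bar> \<le> \<eta> n"
      using \<phi>[of n] by (auto simp: good_def)
    have "f \<in> S n" by (simp add: S_def)
    have vf: "v n f \<le> ?I + \<kappa> / 2 + \<eta> n"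
      using \<phi>v[THEN bspec, OF \<open>f \<in> S n\<close>] n(3) by linarith
    show "\<exists>\<^sub>F j in sequentially. \<exists>E.
         separated_in \<epsilon> j (sofic_Map_measure X \<alpha> \<mu> \<rho> F' L \<delta> (d j) (\<sigma> j)) E \<and>
         exp ((r - ?I - \<kappa>) * d j) < card E"
      using v[of n]
    proof (rule frequently_elim1, clarify)
      fix j D assume D: "good n (v n) j D"
      have DX: "\<psi> \<in> {1..d j} \<rightarrow> topspace X" if "\<psi> \<in> D" for \<psi>
        using D that sofic_Map_funcset unfolding good_def Y_def by blast
      have Dv: "\<forall>u\<in>S n. \<bar>emp_avg (d j) \<psi> u - v n u\<bar> \<le> \<eta> n" if "\<psi> \<in> D" for \<psi>
        using D that by (simp add: good_def)
      have "D \<subseteq> sofic_Map_measure X \<alpha> \<mu> \<rho> F' L \<delta> (d j) (\<sigma> j)"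
      proof
        fix \<psi> assume "\<psi> \<in> D"
        then have "\<psi> \<in> Y n j" using D by (auto simp: good_def)
        then have "\<psi> \<in> sofic_Map X \<alpha> \<rho> F' \<delta> (d j) (\<sigma> j)"
          using n(1,2) by (fastforce simp: Y_def sofic_Map_def)
        moreover have "\<bar>emp_avg (d j) \<psi> g - integral\<^sup>L \<mu> g\<bar> < \<delta>" if "g \<in> L" for g
        proof -
          have "\<bar>emp_avg (d j) \<psi> g - emp_avg (d (i n)) (\<phi> n) g\<bar> < \<delta> / 2"
            using determined[OF that] DX[OF \<open>\<psi> \<in> D\<close>] \<phi>X Dv[OF \<open>\<psi> \<in> D\<close>] \<phi>v
            unfolding determined_def by blast
          with n(4)[OF that] show ?thesis by linarith
        qed
        ultimately show "\<psi> \<in> sofic_Map_measure X \<alpha> \<mu> \<rho> F' L \<delta> (d j) (\<sigma> j)"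
          by (simp add: sofic_Map_measure_def emp_avg_def)
      qed
      moreover have "exp ((r - ?I - \<kappa>) * d j) < card D"
      proof -
        have "(\<Sum>a=1..d j. f (\<psi> a)) \<le> (?I + \<kappa> / 2 + 2 * \<eta> n) * d j" if "\<psi> \<in> D" for \<psi>
          unfolding sum_eq_emp_avg
          using Dv[OF that, THEN bspec, OF \<open>f \<in> S n\<close>] vf by (intro mult_right_mono) auto
        then have "(\<Sum>\<psi>\<in>D. exp (\<Sum>a=1..d j. f (\<psi> a))) \<le> card D * exp ((?I + \<kappa> / 2 + 2 * \<eta> n) * d j)"
          by (intro sum_bounded_above) simp
        then have "exp ((r - \<eta> n) * d j) < card D * exp ((?I + \<kappa> / 2 + 2 * \<eta> n) * d j)"
          using D by (simp add: good_def)
        moreover have "exp ((r - \<eta> n) * d j) =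
            exp ((r - ?I - \<kappa> / 2 - 3 * \<eta> n) * d j) * exp ((?I + \<kappa> / 2 + 2 * \<eta> n) * d j)"
          by (simp add: exp_add[symmetric] algebra_simps)
        ultimately have "exp ((r - ?I - \<kappa> / 2 - 3 * \<eta> n) * d j) < card D" by simp
        moreover have "(r - ?I - \<kappa>) * d j \<le> (r - ?I - \<kappa> / 2 - 3 * \<eta> n) * d j"
          using n(2) by (intro mult_right_mono) auto
        ultimately show ?thesis
          by (meson exp_le_cancel_iff order.strict_trans1)
      qed
      ultimately show "\<exists>E. separated_in \<epsilon> j (sofic_Map_measure X \<alpha> \<mu> \<rho> F' L \<delta> (d j) (\<sigma> j)) E \<and>
         exp ((r - ?I - \<kappa>) * d j) < card E"
        using D unfolding good_def by blast
    qed
  qed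
  have "ereal (r - ?I) \<le> sofic_measure_entropy G d \<sigma> X \<alpha> \<rho> \<mu>"
  proof (rule ereal_le_epsilon2)
    fix \<kappa> :: real assume "0 < \<kappa>"
    then show "ereal (r - ?I) \<le> sofic_measure_entropy G d \<sigma> X \<alpha> \<rho> \<mu> + ereal \<kappa>"
      using entropy[OF \<open>0 < \<kappa>\<close>] by (cases "sofic_measure_entropy G d \<sigma> X \<alpha> \<rho> \<mu>") auto
  qed
  then have "ereal r \<le> sofic_measure_entropy G d \<sigma> X \<alpha> \<rho> \<mu> + ereal ?I"
    by (cases "sofic_measure_entropy G d \<sigma> X \<alpha> \<rho> \<mu>") auto
  moreover have "\<mu> \<in> invariant_measures G X \<alpha>"
    using \<mu> invariant by (simp add: invariant_measures_def)
  ultimately show ?thesis by blast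
qed

end

theorem theorem1p2:
  fixes G :: "('g, 'b) monoid_scheme"
    and d :: "nat \<Rightarrow> nat" and \<sigma> :: "nat \<Rightarrow> 'g \<Rightarrow> nat \<Rightarrow> nat"
    and X :: "'x topology" and \<alpha> :: "'g \<Rightarrow> 'x \<Rightarrow> 'x"
    and \<rho> :: "'x \<Rightarrow> 'x \<Rightarrow> real" and f :: "'x \<Rightarrow> real"
  assumes "sofic_group G"
    and "sofic_approximation G d \<sigma>"
    and "compact_space X" and "metrizable_space X"
    and "continuous_action G X \<alpha>"
    and "compatible_metric X \<rho>"
    and "continuous_map X euclideanreal f"
  shows "sofic_pressure G d \<sigma> X \<alpha> \<rho> f =
           (SUP \<mu> \<in> invariant_measures G X \<alpha>.
              sofic_measure_entropy G d \<sigma> X \<alpha> \<rho> \<mu> + ereal (integral\<^sup>L \<mu> f)) \<and>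
         (sofic_pressure G d \<sigma> X \<alpha> \<rho> f \<noteq> -\<infinity> \<longrightarrow> invariant_measures G X \<alpha> \<noteq> {})"
proof -
  obtain c where "coded_compact_space X \<rho> c"
    using ex_coded_compact_space assms(3,6) by blast
  then interpret coded_sofic_action X \<rho> c G d \<sigma> \<alpha>
    using assms by (simp add: coded_sofic_action_def coded_sofic_action_axioms_def)
  let ?P = "sofic_pressure G d \<sigma> X \<alpha> \<rho> f"
  let ?value = "\<lambda>\<mu>. sofic_measure_entropy G d \<sigma> X \<alpha> \<rho> \<mu> + ereal (integral\<^sup>L \<mu> f)"
  have below: "\<exists>\<mu>\<in>invariant_measures G X \<alpha>. ereal r \<le> ?value \<mu>" if "ereal r < ?P" for r
    by (rule exists_measure_of_less_pressure[OF assms(7) that])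
  have "?P = (SUP \<mu> \<in> invariant_measures G X \<alpha>. ?value \<mu>)"
  proof (rule antisym)
    show "?P \<le> (SUP \<mu> \<in> invariant_measures G X \<alpha>. ?value \<mu>)"
      by (rule ereal_le_of_reals_below) (meson below SUP_upper2)
    show "(SUP \<mu> \<in> invariant_measures G X \<alpha>. ?value \<mu>) \<le> ?P"
      by (rule SUP_least) (rule entropy_plus_integral_le_pressure[OF assms(7)])
  qed
  moreover have "invariant_measures G X \<alpha> \<noteq> {}" if "?P \<noteq> -\<infinity>"
  proof -
    from that obtain r where "ereal r < ?P"
      using ereal_dense2[of "-\<infinity>" ?P] by auto
    then show ?thesis using below by blast
  qed
  ultimately show ?thesis by blast
qed

end
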